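(* Let $b$ be a connected graph over $X$, let $q:X\to\mathbb{R}$ be a given potential, and let $H=L+q$ be the associated formal Schrödinger operator with form $h$. Let $u$ and $v$ be positive functions such that $u$ and $v-u$ are positive $H$-superharmonic functions on $X$ that are $H$-harmonic outside of a finite set. Let $u_0:=u/v$ and assume (a) the map $u_0:X\to(0,1)$ is proper and satisfies $\sup u_0=1$; (b) $\displaystyle\sup_{x,y\in X,\ x\sim y}\frac{u_0(x)(1-u_0(y))}{u_0(y)(1-u_0(x))}<\infty$. Then the function $$w:=\frac{H\left[u^{1/2}(v-u)^{1/2}\right]}{u^{1/2}(v-u)^{1/2}}$$ is an optimal Hardy-weight (for $h$) in $X$, and $$w(x)=\frac12\sum_{y\in X}b(x,y)\left[\left(\frac{u(y)}{u(x)}\right)^{1/2}-\left(\frac{(v-u)(y)}{(v-u)(x)}\right)^{1/2}\right]^2$$ for all $x\in X$ satisfying $Hu(x)=Hv(x)=0$.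
   Context: $X$ is a countably infinite discrete set. A graph over $X$ is a symmetric function $b:X\times X\to[0,\infty)$ with zero diagonal and $\sum_{y}b(x,y)<\infty$ for all $x$ (not necessarily locally finite). Write $x\sim y$ if $b(x,y)>0$; $b$ is connected if any two vertices are joined by a finite path $x_0\sim x_1\sim\dots\sim x_n$. A function $f:X\to\mathbb{R}$ is called proper (on $X$) if $f^{-1}(I)$ is compact (i.e. finite) for all compact $I\subseteq f(X):=\{f(x)\mid x\in X\}$. $C(W)$ is the space of real functions on $W\subseteq X$ and $C_c(W)$ the subspace of finitely supported ones, both viewed in $C(X)$ by extension by zero. A function $f$ is positive if $f\ge0$ and $f\ne0$. $F(X):=\{f\in C(X):\sum_y b(x,y)|f(y)|<\infty\ \forall x\}$; for $f\in F(X)$, $Lf(x):=\sum_{y}b(x,y)(f(x)-f(y))$ and $H:=L+q$. The form of $H$ is $$h(\varphi):=\tfrac12\sum_{x,y\in X}b(x,y)(\varphi(x)-\varphi(y))^2+\sum_{x\in X}q(x)\varphi(x)^2,\quad \varphi\in C_c(X).$$ A function $f$ is $H$-superharmonic ($H$-harmonic) on $W\subseteq X$ if $f\in F(X)$ and $Hf\ge0$ ($Hf=0$) on $W$. (Positive $H$-superharmonic functions on $X$ are strictly positive, by the Harnack inequality.) A function $w:X\to\mathbb{R}$ also denotes the quadratic form $w(\varphi):=\sum_x w(x)\varphi(x)^2$ on $C_c(X)$. Optimal Hardy-weight. Let $w:X\to[0,\infty)$ be positive with $h-w\ge0$ on $C_c(X)$. * $h-w$ is critical in $X$ if there is no positive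 $\tilde w\in C(X)$ with $h-w-\tilde w\ge0$ on $C_c(X)$. In this case there is a unique (up to constant multiples) positive $(H-w)$-superharmonic function $\psi$ on $X$; it is $(H-w)$-harmonic and is called the ground state of $h-w$. * $h-w$ is null-critical in $X$ with respect to $w$ if it is critical in $X$ and $\sum_X\psi^2w=\infty$, where $\psi$ is the ground state of $h-w$. * $w$ is optimal near infinity for $h$ if for every $\lambda>0$ and every finite $W\subseteq X$ the inequality $h-w\ge\lambda w$ fails to hold on $C_c(X\setminus W)$. $w$ is an optimal Hardy-weight for $h$ in $X$ if $h-w$ is critical in $X$, null-critical in $X$ with respect to $w$, and $w$ is optimal near infinity for $h$.
   Formalization: Properness of u_0 is taken relative to the codomain (0,1): preimages of all compact subsets of (0,1) are finite. Testing only compact subsets of the image u_0(X), as literally defined, makes the claim false (a star of three transient rays with limits 1, 1/2, 0). *)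

theory Defs
  imports "HOL-Analysis.Analysis"
begin

text \<open>The discrete vertex set is the universe of a type \<open>'a\<close>. Infinite sums are the unordered
  sums \<open>infsum\<close>; for real terms \<open>summable_on\<close> is absolute summability.\<close>

definition graph_over :: "('a \<Rightarrow> 'a \<Rightarrow> real) \<Rightarrow> bool" where
  "graph_over b \<longleftrightarrow>
     (\<forall>x y. b x y = b y x) \<and> (\<forall>x y. 0 \<le> b x y) \<and> (\<forall>x. b x x = 0) \<and>
     (\<forall>x. (\<lambda>y. b x y) summable_on UNIV)"

definition adj :: "('a \<Rightarrow> 'a \<Rightarrow> real) \<Rightarrow> 'a \<Rightarrow> 'a \<Rightarrow> bool" where
  "adj b x y \<longleftrightarrow> b x y > 0"

definition connected_graph :: "('a \<Rightarrow> 'a \<Rightarrow> real) \<Rightarrow> bool" where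
  "connected_graph b \<longleftrightarrow> (\<forall>x y. (adj b)\<^sup>*\<^sup>* x y)"

definition Cc :: "'a set \<Rightarrow> ('a \<Rightarrow> real) set" where
  "Cc W = {\<phi>. finite {x. \<phi> x \<noteq> 0} \<and> {x. \<phi> x \<noteq> 0} \<subseteq> W}"

definition positive :: "('a \<Rightarrow> real) \<Rightarrow> bool" where
  "positive f \<longleftrightarrow> (\<forall>x. 0 \<le> f x) \<and> (\<exists>x. f x \<noteq> 0)"

text \<open>Properness is relative to the codomain \<open>S\<close>: for a map \<open>X \<rightarrow> (0,1)\<close> the test sets are the
  compact subsets of \<open>(0,1)\<close>. Testing only compact subsets of the image \<open>f(X)\<close>, which is
  countable here, would not exclude that \<open>f\<close> accumulates at a point of \<open>S\<close> outside \<open>f(X)\<close>.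
  Compact subsets of the discrete domain are the finite ones.\<close>

definition proper_into :: "real set \<Rightarrow> ('a \<Rightarrow> real) \<Rightarrow> bool" where
  "proper_into S f \<longleftrightarrow>
     range f \<subseteq> S \<and> (\<forall>I. compact I \<and> I \<subseteq> S \<longrightarrow> finite (f -` I))"

definition formal_domain :: "('a \<Rightarrow> 'a \<Rightarrow> real) \<Rightarrow> ('a \<Rightarrow> real) set" where
  "formal_domain b = {f. \<forall>x. (\<lambda>y. b x y * \<bar>f y\<bar>) summable_on UNIV}"

definition laplacian :: "('a \<Rightarrow> 'a \<Rightarrow> real) \<Rightarrow> ('a \<Rightarrow> real) \<Rightarrow> 'a \<Rightarrow> real" where
  "laplacian b f x = (\<Sum>\<^sub>\<infinity>y. b x y * (f x - f y))"

definition schroedinger ::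
  "('a \<Rightarrow> 'a \<Rightarrow> real) \<Rightarrow> ('a \<Rightarrow> real) \<Rightarrow> ('a \<Rightarrow> real) \<Rightarrow> 'a \<Rightarrow> real" where
  "schroedinger b q f x = laplacian b f x + q x * f x"

definition pot_form :: "('a \<Rightarrow> real) \<Rightarrow> ('a \<Rightarrow> real) \<Rightarrow> real" where
  "pot_form w \<phi> = (\<Sum>\<^sub>\<infinity>x. w x * (\<phi> x)\<^sup>2)"

definition schroedinger_form ::
  "('a \<Rightarrow> 'a \<Rightarrow> real) \<Rightarrow> ('a \<Rightarrow> real) \<Rightarrow> ('a \<Rightarrow> real) \<Rightarrow> real" where
  "schroedinger_form b q \<phi> =
     1/2 * (\<Sum>\<^sub>\<infinity>(x, y)\<in>UNIV. b x y * (\<phi> x - \<phi> y)\<^sup>2) + pot_form q \<phi>"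

definition superharmonic_on ::
  "('a \<Rightarrow> 'a \<Rightarrow> real) \<Rightarrow> ('a \<Rightarrow> real) \<Rightarrow> 'a set \<Rightarrow> ('a \<Rightarrow> real) \<Rightarrow> bool" where
  "superharmonic_on b q W f \<longleftrightarrow>
     f \<in> formal_domain b \<and> (\<forall>x\<in>W. schroedinger b q f x \<ge> 0)"

definition harmonic_on ::
  "('a \<Rightarrow> 'a \<Rightarrow> real) \<Rightarrow> ('a \<Rightarrow> real) \<Rightarrow> 'a set \<Rightarrow> ('a \<Rightarrow> real) \<Rightarrow> bool" where
  "harmonic_on b q W f \<longleftrightarrow>
     f \<in> formal_domain b \<and> (\<forall>x\<in>W. schroedinger b q f x = 0)"

definition critical ::
  "('a \<Rightarrow> 'a \<Rightarrow> real) \<Rightarrow> ('a \<Rightarrow> real) \<Rightarrow> ('a \<Rightarrow> real) \<Rightarrow> bool" where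
  "critical b q w \<longleftrightarrow>
     \<not> (\<exists>w'. positive w' \<and>
          (\<forall>\<phi>\<in>Cc UNIV. schroedinger_form b q \<phi> - pot_form w \<phi> - pot_form w' \<phi> \<ge> 0))"

text \<open>The operator \<open>H - w\<close> is the Schroedinger operator with potential \<open>q - w\<close>.\<close>

definition ground_state ::
  "('a \<Rightarrow> 'a \<Rightarrow> real) \<Rightarrow> ('a \<Rightarrow> real) \<Rightarrow> ('a \<Rightarrow> real) \<Rightarrow> ('a \<Rightarrow> real) \<Rightarrow> bool" where
  "ground_state b q w \<psi> \<longleftrightarrow>
     positive \<psi> \<and> superharmonic_on b (\<lambda>x. q x - w x) UNIV \<psi> \<and>
     (\<forall>f. positive f \<and> superharmonic_on b (\<lambda>x. q x - w x) UNIV f \<longrightarrow>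
          (\<exists>c. \<forall>x. f x = c * \<psi> x))"

text \<open>A ground state is unique up to a positive factor, so the existential quantifier below
  speaks about the ground state. The sum is taken in the extended nonnegative reals.\<close>

definition null_critical ::
  "('a \<Rightarrow> 'a \<Rightarrow> real) \<Rightarrow> ('a \<Rightarrow> real) \<Rightarrow> ('a \<Rightarrow> real) \<Rightarrow> bool" where
  "null_critical b q w \<longleftrightarrow>
     critical b q w \<and>
     (\<exists>\<psi>. ground_state b q w \<psi> \<and> (\<Sum>\<^sub>\<infinity>x. ennreal ((\<psi> x)\<^sup>2 * w x)) = \<infinity>)"

definition optimal_near_infinity ::
  "('a \<Rightarrow> 'a \<Rightarrow> real) \<Rightarrow> ('a \<Rightarrow> real) \<Rightarrow> ('a \<Rightarrow> real) \<Rightarrow> bool" where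
  "optimal_near_infinity b q w \<longleftrightarrow>
     (\<forall>\<mu>>0. \<forall>W. finite W \<longrightarrow>
        \<not> (\<forall>\<phi>\<in>Cc (UNIV - W).
              schroedinger_form b q \<phi> - pot_form w \<phi> \<ge> \<mu> * pot_form w \<phi>))"

definition optimal_hardy_weight ::
  "('a \<Rightarrow> 'a \<Rightarrow> real) \<Rightarrow> ('a \<Rightarrow> real) \<Rightarrow> ('a \<Rightarrow> real) \<Rightarrow> bool" where
  "optimal_hardy_weight b q w \<longleftrightarrow>
     positive w \<and>
     (\<forall>\<phi>\<in>Cc UNIV. schroedinger_form b q \<phi> - pot_form w \<phi> \<ge> 0) \<and>
     critical b q w \<and> null_critical b q w \<and> optimal_near_infinity b q w"

end

theory Submission
  imports Defs
begin

text \<open>Put \<open>f = u\<close>, \<open>g = v - u\<close>, \<open>r = f / g\<close> and \<open>\<psi> = (f g)\<^sup>1\<^sup>/\<^sup>2\<close>. The function \<open>\<psi>\<close> is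
  \<open>(H - w)\<close>-harmonic, so the ground state transform turns \<open>h - w\<close> into the energy with edge weights
  \<open>b(x,y) \<psi>(x) \<psi>(y)\<close>. Criticality, uniqueness of the ground state and optimality near infinity all
  follow from a null sequence \<open>e\<^sub>n\<close> for this energy, the last one together with \<open>\<Sum> w \<psi>\<^sup>2 = \<infinity>\<close>.

  For the edge weights \<open>c(x,y) = b(x,y) g(x) g(y)\<close>, the function \<open>r\<close> is harmonic outside a finite set.
  Testing this with finitely supported functions of the form \<open>k 1\<^bsub>{r > s}\<^esub> - D\<close>, where \<open>D\<close> is a
  truncation of \<open>ln r\<close>, evaluates \<open>\<Sum> c(x,y) (r(x) - r(y)) (D(x) - D(y))\<close> in terms of the flux of
  \<open>r\<close> through the level \<open>s\<close>; this plays the role of the coarea formula. The value grows linearly in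
  the length of the truncation. As \<open>e\<^sub>n\<close> is \<open>1 - \<bar>D\<bar> / n\<close>, its energy is \<open>O(1 / n)\<close>. On the other
  hand, edgewise and by the ratio bound (b), \<open>(r(x) - r(y)) (ln r(x) - ln r(y))\<close> is at most a constant
  times \<open>(r(x)\<^sup>1\<^sup>/\<^sup>2 - r(y)\<^sup>1\<^sup>/\<^sup>2)\<^sup>2\<close>, whose \<open>c\<close>-weighted sum is bounded by \<open>2 \<Sum> w \<psi>\<^sup>2\<close>.\<close>

section \<open>Double sums with finitely many nonzero rows, and Green's formula\<close>

lemma summable_on_diff:
  fixes f g :: "'a \<Rightarrow> real"
  assumes "f summable_on A" and "g summable_on A"
  shows "(\<lambda>x. f x - g x) summable_on A"
  using summable_on_add[of f A "\<lambda>x. - g x"] assms by (simp add: summable_on_uminus)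

text \<open>The support lies in finitely many slices \<open>{x} \<times> UNIV\<close>, and their
  sums add up. A vertex may have infinitely many neighbours, so finitely many rows do not yet make
  the double sum a finite one.\<close>

lemma has_sum_finite_rows:
  fixes k :: "'a \<Rightarrow> 'b \<Rightarrow> real"
  assumes S: "finite S"
    and rows: "\<And>x. x \<in> S \<Longrightarrow> k x summable_on UNIV"
    and zero: "\<And>x y. x \<notin> S \<Longrightarrow> k x y = 0"
  shows "((\<lambda>(x, y). k x y) has_sum (\<Sum>x\<in>S. infsum (k x) UNIV)) UNIV"
proof -
  have "((\<lambda>(x, y). k x y) has_sum infsum (k x) UNIV) ({x} \<times> UNIV)" if "x \<in> S" for x
  proof -
    have inj: "inj (Pair x)" for x :: 'a by (auto simp: inj_on_def)
    have "((\<lambda>(x, y). k x y) has_sum infsum (k x) UNIV) (range (Pair x))"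
      using has_sum_reindex[OF inj, where g = "\<lambda>(x, y). k x y"] rows[OF that]
      by (simp add: o_def)
    moreover have "range (Pair x) = {x} \<times> (UNIV :: 'b set)" by auto
    ultimately show ?thesis by simp
  qed
  then have "((\<lambda>(x, y). k x y) has_sum (\<Sum>x\<in>S. infsum (k x) UNIV)) (\<Union>x\<in>S. {x} \<times> UNIV)"
    using S by (intro sum_has_sum) auto
  moreover have "(\<Union>x\<in>S. {x} \<times> (UNIV :: 'b set)) = S \<times> UNIV" by auto
  ultimately have "((\<lambda>(x, y). k x y) has_sum (\<Sum>x\<in>S. infsum (k x) UNIV)) (S \<times> UNIV)"
    by simp
  then show ?thesis
    by (rule has_sum_cong_neutral[THEN iffD1, rotated -1]) (use zero in auto)
qed

text \<open>The half with factor \<open>T x\<close> has finitely many nonzero rows and is summed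
  first. Swapping the variables turns it into the half with factor \<open>- T y\<close>, by symmetry
  of \<open>c\<close>; hence the factor 2.\<close>

lemma green_formula:
  fixes c :: "'a \<Rightarrow> 'a \<Rightarrow> real"
  assumes sym: "\<And>x y. c x y = c y x"
    and rows: "\<And>x. (\<lambda>y. c x y * (g x - g y)) summable_on UNIV"
    and S: "finite S" and T: "\<And>x. x \<notin> S \<Longrightarrow> T x = 0"
  shows "((\<lambda>(x, y). c x y * (g x - g y) * (T x - T y)) has_sum
            2 * (\<Sum>x\<in>S. T x * laplacian c g x)) UNIV"
proof -
  define s where "s = (\<Sum>x\<in>S. T x * laplacian c g x)"
  have one: "((\<lambda>(x, y). T x * (c x y * (g x - g y))) has_sum s) UNIV"
    unfolding s_def laplacian_def infsum_cmult_right'[symmetric]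
    using S T rows by (intro has_sum_finite_rows) (auto intro: summable_on_cmult_right)
  then have "((\<lambda>(x, y). T y * (c y x * (g y - g x))) has_sum s) UNIV"
    using has_sum_swap[where f = "\<lambda>(x, y). T x * (c x y * (g x - g y))" and A = UNIV and B = UNIV] by simp
  from has_sum_add[OF one this] show ?thesis
    unfolding s_def[symmetric] mult_2
    by (rule has_sum_cong[THEN iffD1, rotated]) (auto simp: sym algebra_simps)
qed

section \<open>Basic facts on graphs, the formal domain and quadratic forms\<close>

lemma graph_overD:
  assumes "graph_over b"
  shows "b x y = b y x" and "0 \<le> b x y" and "(\<lambda>y. b x y) summable_on UNIV"
  using assms unfolding graph_over_def by blast+

lemma abs_graph_mult:
  assumes "graph_over b"
  shows "\<bar>b x y * f y\<bar> = b x y * \<bar>f y\<bar>"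
  using graph_overD(2)[OF assms, of x y] by (simp add: abs_mult)

lemma formal_domainD:
  assumes "graph_over b" and "f \<in> formal_domain b"
  shows "(\<lambda>y. b x y * f y) summable_on UNIV"
    and "(\<lambda>y. b x y * (f x - f y)) summable_on UNIV"
proof -
  have "(\<lambda>y. \<bar>b x y * f y\<bar>) summable_on UNIV"
    using assms(2) unfolding formal_domain_def by (simp add: abs_graph_mult[OF assms(1)])
  then show *: "(\<lambda>y. b x y * f y) summable_on UNIV"
    by (rule summable_on_iff_abs_summable_on_real[THEN iffD2, unfolded real_norm_def])
  have "(\<lambda>y. b x y * f x) summable_on UNIV"
    by (rule summable_on_cmult_left[OF graph_overD(3)[OF assms(1)]])
  from summable_on_diff[OF this *] show "(\<lambda>y. b x y * (f x - f y)) summable_on UNIV"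
    by (simp add: algebra_simps)
qed

lemma formal_domainI:
  assumes "graph_over b" and "\<And>x. (\<lambda>y. b x y * f y) summable_on UNIV"
  shows "f \<in> formal_domain b"
proof -
  have "(\<lambda>y. \<bar>b x y * f y\<bar>) summable_on UNIV" for x
    by (rule summable_on_iff_abs_summable_on_real[THEN iffD1, unfolded real_norm_def, OF assms(2)])
  then show ?thesis
    unfolding formal_domain_def by (simp add: abs_graph_mult[OF assms(1)])
qed

lemma pot_form_eq_sum:
  assumes "finite S" and "\<And>x. x \<notin> S \<Longrightarrow> \<phi> x = 0"
  shows "pot_form p \<phi> = (\<Sum>x\<in>S. p x * (\<phi> x)\<^sup>2)"
  unfolding pot_form_def
  by (rule infsumI, rule has_sum_finite_neutralI[OF assms(1)]) (use assms(2) in auto)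

text \<open>Absorbing \<open>w\<close> into the potential lets the results for a general potential
  \<open>p\<close> apply to \<open>h - w\<close>.\<close>

lemma schroedinger_form_minus_pot_form:
  assumes "\<phi> \<in> Cc W"
  shows "schroedinger_form b q \<phi> - pot_form w \<phi> = schroedinger_form b (\<lambda>x. q x - w x) \<phi>"
proof -
  define S where "S = {x. \<phi> x \<noteq> 0}"
  have S: "finite S" "\<And>x. x \<notin> S \<Longrightarrow> \<phi> x = 0" using assms by (auto simp: Cc_def S_def)
  show ?thesis
    by (simp add: schroedinger_form_def pot_form_eq_sum[OF S] algebra_simps sum_subtractf)
qed

section \<open>The ground state transform\<close>

text \<open>Ordered pairs without a factor 1/2: twice the Dirichlet energy of \<open>e\<close> for
  the edge weights \<open>b x y * f x * f y\<close>.\<close>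

definition transformed_energy ::
  "('a \<Rightarrow> 'a \<Rightarrow> real) \<Rightarrow> ('a \<Rightarrow> real) \<Rightarrow> ('a \<Rightarrow> real) \<Rightarrow> real" where
  "transformed_energy b f e = (\<Sum>\<^sub>\<infinity>(x, y)\<in>UNIV. b x y * f x * f y * (e x - e y)\<^sup>2)"

lemma weighted_formal_domainD:
  assumes "graph_over b" and "f \<in> formal_domain b"
  shows "(\<lambda>y. b x y * f x * f y) summable_on UNIV"
  using summable_on_cmult_right[OF formal_domainD(1)[OF assms, of x], of "f x"]
  by (simp add: mult_ac)

text \<open>Green's formula for the weights \<open>b x y * f x * f y\<close>, with \<open>e\<close>
  in both roles. Their row sums are finite because \<open>f\<close> lies in the formal
  domain.\<close>

lemma transformed_energy_summable:
  assumes b: "graph_over b" and f: "f \<in> formal_domain b" and e: "e \<in> Cc W"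
  shows "(\<lambda>(x, y). b x y * f x * f y * (e x - e y)\<^sup>2) summable_on UNIV"
proof -
  define S where "S = {x. e x \<noteq> 0}"
  have S: "finite S" "\<And>x. x \<notin> S \<Longrightarrow> e x = 0" using e by (auto simp: Cc_def S_def)
  have "((\<lambda>(x, y). b x y * f x * f y * (e x - e y) * (e x - e y)) has_sum
            2 * (\<Sum>x\<in>S. e x * laplacian (\<lambda>x y. b x y * f x * f y) e x)) UNIV"
  proof (rule green_formula[OF _ _ S])
    have "(\<lambda>y. b x y * f x * f y * e y) summable_on UNIV" for x
      by (rule finite_nonzero_values_imp_summable_on)
        (rule finite_subset[OF _ S(1)], auto simp: S_def)
    then show "(\<lambda>y. b x y * f x * f y * (e x - e y)) summable_on UNIV" for x
      using summable_on_diff[OF summable_on_cmult_left[OF weighted_formal_domainD[OF b f, of x]]]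
      by (fastforce simp: algebra_simps)
    show "b x y * f x * f y = b y x * f y * f x" for x y
      using graph_overD(1)[OF b, of x y] by simp
  qed
  then show ?thesis by (auto simp: power2_eq_square mult.assoc dest!: has_sum_imp_summable)
qed

text \<open>Green's formula for \<open>f\<close> tested with
  \<open>(\<phi> x)\<^sup>2 / f x\<close>. The last sum vanishes for harmonic \<open>f\<close> and
  is nonnegative for superharmonic \<open>f\<close>; the first case serves \<psi>, the second the
  competitors in the uniqueness proof.\<close>

lemma ground_state_representation:
  assumes b: "graph_over b" and f: "f \<in> formal_domain b" "\<And>x. f x > 0" and \<phi>: "\<phi> \<in> Cc W"
  shows "schroedinger_form b p \<phi> =
    1/2 * transformed_energy b f (\<lambda>x. \<phi> x / f x) +
    (\<Sum>\<^sub>\<infinity>x. schroedinger b p f x / f x * (\<phi> x)\<^sup>2)"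
proof -
  define S where "S = {x. \<phi> x \<noteq> 0}"
  have S: "finite S" "\<And>x. x \<notin> S \<Longrightarrow> \<phi> x = 0" using \<phi> by (auto simp: Cc_def S_def)
  have sym: "b x y = b y x" for x y by (rule graph_overD(1)[OF b])
  define T where "T x = (\<phi> x)\<^sup>2 / f x" for x
  have T: "T x = 0" if "x \<notin> S" for x using S(2)[OF that] by (simp add: T_def)
  have g: "((\<lambda>(x, y). b x y * (f x - f y) * (T x - T y)) has_sum
      2 * (\<Sum>x\<in>S. T x * laplacian b f x)) UNIV"
    by (rule green_formula[OF sym formal_domainD(2)[OF b f(1)] S(1) T])
  have e: "((\<lambda>(x, y). b x y * f x * f y * (\<phi> x / f x - \<phi> y / f y)\<^sup>2) has_sum
      transformed_energy b f (\<lambda>x. \<phi> x / f x)) UNIV"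
    unfolding transformed_energy_def using \<phi>
    by (intro has_sum_infsum transformed_energy_summable[OF b f(1), of _ W]) (auto simp: Cc_def)
  \<comment> \<open>Picone's identity on a single edge.\<close>
  have id: "f x * f y * (\<phi> x / f x - \<phi> y / f y)\<^sup>2 + (f x - f y) * (T x - T y) = (\<phi> x - \<phi> y)\<^sup>2" for x y
    using f(2)[of x] f(2)[of y] by (simp add: T_def field_simps power2_eq_square)
  have "((\<lambda>(x, y). b x y * (\<phi> x - \<phi> y)\<^sup>2) has_sum
      (transformed_energy b f (\<lambda>x. \<phi> x / f x) + 2 * (\<Sum>x\<in>S. T x * laplacian b f x))) UNIV"
    using has_sum_add[OF e g]
    by (rule has_sum_cong[THEN iffD1, rotated])
      (auto simp: id[symmetric] algebra_simps)
  moreover have "(\<Sum>\<^sub>\<infinity>x. schroedinger b p f x / f x * (\<phi> x)\<^sup>2) =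
      (\<Sum>x\<in>S. schroedinger b p f x / f x * (\<phi> x)\<^sup>2)"
    by (rule infsumI, rule has_sum_finite_neutralI[OF S(1)]) (use S(2) in auto)
  moreover have "schroedinger b p f x / f x * (\<phi> x)\<^sup>2 = T x * laplacian b f x + p x * (\<phi> x)\<^sup>2" for x
    using f(2)[of x] by (simp add: schroedinger_def T_def field_simps)
  ultimately show ?thesis
    by (simp add: schroedinger_form_def infsumI pot_form_eq_sum[OF S] sum.distrib)
qed

text \<open>At a zero \<open>y\<close> of \<open>f\<close> the operator reduces to minus the sum of
  \<open>b y t * f t\<close>, so superharmonicity forces \<open>f\<close> to vanish at all
  neighbours of \<open>y\<close> and, by connectedness, everywhere.\<close>

lemma positive_superharmonic_pos:
  assumes b: "graph_over b" and conn: "connected_graph b"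
    and f: "positive f" "superharmonic_on b p UNIV f"
  shows "f x > 0"
proof (rule ccontr)
  assume "\<not> f x > 0"
  have f0: "f z \<ge> 0" for z using f by (simp add: positive_def)
  have fd: "f \<in> formal_domain b" using f by (simp add: superharmonic_on_def)
  have step: "f z = 0" if "f y = 0" "adj b y z" for y z
  proof -
    have nonneg: "b y t * f t \<ge> 0" for t using graph_overD(2)[OF b] f0 by simp
    have "0 \<le> schroedinger b p f y" using f by (simp add: superharmonic_on_def)
    also have "schroedinger b p f y = - (\<Sum>\<^sub>\<infinity>t. b y t * f t)"
      using that by (simp add: schroedinger_def laplacian_def infsum_uminus)
    finally have "(\<Sum>\<^sub>\<infinity>t. b y t * f t) \<le> 0" by simp
    then have "b y z * f z = 0"
      using nonneg_infsum_le_0D[of "\<lambda>t. b y t * f t" UNIV z] formal_domainD(1)[OF b fd] nonneg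
      by simp
    then show ?thesis using that by (simp add: adj_def)
  qed
  have "f x = 0" using \<open>\<not> f x > 0\<close> f0[of x] by simp
  moreover have "(adj b)\<^sup>*\<^sup>* x y" for y using conn by (simp add: connected_graph_def)
  then have "f x = 0 \<longrightarrow> f y = 0" for y
    by (rule rtranclp_induct) (auto intro: step)
  ultimately show False using f by (auto simp: positive_def)
qed

lemma transformed_energy_nonneg:
  assumes b: "graph_over b" and f: "\<And>x. f x > 0"
  shows "transformed_energy b f e \<ge> 0"
  unfolding transformed_energy_def
  by (rule infsum_nonneg) (auto intro!: mult_nonneg_nonneg graph_overD(2)[OF b] less_imp_le[OF f])

lemma edge_le_transformed_energy:
  assumes b: "graph_over b" and f: "f \<in> formal_domain b" "\<And>x. f x > 0" and e: "e \<in> Cc W"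
  shows "b x y * f x * f y * (e x - e y)\<^sup>2 \<le> transformed_energy b f e"
proof -
  have "(\<Sum>(x, y)\<in>{(x, y)}. b x y * f x * f y * (e x - e y)\<^sup>2) \<le> transformed_energy b f e"
    unfolding transformed_energy_def
    by (rule finite_sum_le_infsum[OF transformed_energy_summable[OF b f(1) e]])
      (auto intro!: mult_nonneg_nonneg graph_overD(2)[OF b] less_imp_le[OF f(2)])
  then show ?thesis by simp
qed

lemma sum_le_pot_form:
  assumes "\<phi> \<in> Cc W" and "\<And>x. p x \<ge> 0" and "finite F"
  shows "(\<Sum>x\<in>F. p x * (\<phi> x)\<^sup>2) \<le> pot_form p \<phi>"
  unfolding pot_form_def
proof (rule finite_sum_le_infsum[OF _ assms(3)])
  show "(\<lambda>x. p x * (\<phi> x)\<^sup>2) summable_on UNIV"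
    by (rule finite_nonzero_values_imp_summable_on, rule finite_subset[of _ "{x. \<phi> x \<noteq> 0}"])
      (use assms in \<open>auto simp: Cc_def\<close>)
qed (use assms in auto)

lemma Cc_mult:
  assumes "e \<in> Cc UNIV"
  shows "(\<lambda>x. g x * e x) \<in> Cc {x. g x \<noteq> 0}"
proof -
  have "finite {x. e x \<noteq> 0}" using assms by (simp add: Cc_def)
  then have "finite {x. g x * e x \<noteq> 0}" by (rule rev_finite_subset) auto
  then show ?thesis by (auto simp: Cc_def)
qed

lemma Cc_mono: "\<phi> \<in> Cc V \<Longrightarrow> V \<subseteq> W \<Longrightarrow> \<phi> \<in> Cc W"
  by (auto simp: Cc_def)

section \<open>Consequences of a null sequence\<close>

text \<open>Later \<open>p\<close> is \<open>q - w\<close> and \<open>e\<close> consists of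
  logarithmic cutoffs. The products \<open>\<psi> x * e n x\<close> converge pointwise to
  \<open>\<psi> x\<close> while their form tends to 0.\<close>

locale null_sequence =
  fixes b :: "'a \<Rightarrow> 'a \<Rightarrow> real" and p \<psi> :: "'a \<Rightarrow> real" and e :: "nat \<Rightarrow> 'a \<Rightarrow> real"
  assumes graph: "graph_over b" and conn: "connected_graph b"
    and dom: "\<psi> \<in> formal_domain b" and pos: "\<psi> x > 0"
    and harmonic: "schroedinger b p \<psi> x = 0"
    and e_Cc: "e n \<in> Cc UNIV" and e_ge: "0 \<le> e n x" and e_le: "e n x \<le> 1"
    and e_lim: "(\<lambda>n. e n x) \<longlonglongrightarrow> 1"
    and energy_lim: "(\<lambda>n. transformed_energy b \<psi> (e n)) \<longlonglongrightarrow> 0"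
begin

lemma form_eq:
  assumes "\<eta> \<in> Cc UNIV"
  shows "schroedinger_form b p (\<lambda>x. \<psi> x * \<eta> x) = 1/2 * transformed_energy b \<psi> \<eta>"
proof -
  have "\<psi> x \<noteq> 0" for x using pos[of x] by simp
  then show ?thesis
    using ground_state_representation[OF graph dom pos Cc_mult[OF assms, of \<psi>], of p]
    by (simp add: harmonic)
qed

lemma form_nonneg:
  assumes "\<phi> \<in> Cc UNIV"
  shows "schroedinger_form b p \<phi> \<ge> 0"
  using ground_state_representation[OF graph dom pos assms, of p]
    transformed_energy_nonneg[OF graph, of \<psi> "\<lambda>x. \<phi> x / \<psi> x", OF pos] by (simp add: harmonic)

lemma form_lim: "(\<lambda>n. schroedinger_form b p (\<lambda>x. \<psi> x * e n x)) \<longlonglongrightarrow> 0"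
  using tendsto_mult_left[OF energy_lim, of "1/2"] by (simp add: form_eq[OF e_Cc])

lemma phi_Cc: "(\<lambda>x. \<psi> x * e n x) \<in> Cc UNIV"
  using Cc_mult[OF e_Cc] by (rule Cc_mono) simp

lemma phi_lim: "(\<lambda>n. \<psi> x * e n x) \<longlonglongrightarrow> \<psi> x"
  using tendsto_mult_left[OF e_lim, of "\<psi> x" x] by simp

text \<open>Along \<open>\<psi> x * e n x\<close> the form tends to 0, but the contribution of one
  vertex with \<open>w' x > 0\<close> tends to \<open>w' x * (\<psi> x)\<^sup>2 > 0\<close>.\<close>

lemma not_subcritical:
  assumes "positive w'"
  shows "\<exists>\<phi>\<in>Cc UNIV. schroedinger_form b p \<phi> < pot_form w' \<phi>"
proof (rule ccontr)
  assume "\<not> ?thesis"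
  then have le: "pot_form w' \<phi> \<le> schroedinger_form b p \<phi>" if "\<phi> \<in> Cc UNIV" for \<phi>
    using that by force
  obtain x where "w' x > 0" using assms by (auto simp: positive_def less_le)
  have le': "w' x * (\<psi> x * e n x)\<^sup>2 \<le> schroedinger_form b p (\<lambda>x. \<psi> x * e n x)" for n
    using sum_le_pot_form[OF phi_Cc, of w' "{x}" n] le[OF phi_Cc[of n]] assms
    by (simp add: positive_def)
  have "w' x * (\<psi> x)\<^sup>2 \<le> 0"
  proof (rule LIMSEQ_le[OF _ form_lim])
    show "(\<lambda>n. w' x * (\<psi> x * e n x)\<^sup>2) \<longlonglongrightarrow> w' x * (\<psi> x)\<^sup>2"
      by (intro tendsto_intros phi_lim)
  qed (use le' in blast)
  then show False
    using \<open>w' x > 0\<close> pos[of x] by (simp add: mult_le_0_iff)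
qed

text \<open>The transform with \<open>f\<close> in place of \<psi> has a nonnegative remainder, so
  each edge term of \<open>\<psi> x * e n x / f x\<close> is at most twice a form value tending to
  0. Hence \<open>\<psi> / f\<close> agrees at adjacent vertices and is constant by
  connectedness.\<close>

lemma superharmonic_unique:
  assumes f: "positive f" "superharmonic_on b p UNIV f"
  shows "\<exists>c. \<forall>x. f x = c * \<psi> x"
proof -
  have fpos: "f x > 0" for x
    by (rule positive_superharmonic_pos[OF graph conn f])
  have fdom: "f \<in> formal_domain b" and Hf: "schroedinger b p f x \<ge> 0" for x
    using f by (auto simp: superharmonic_on_def)
  have step: "\<psi> x / f x = \<psi> y / f y" if "adj b x y" for x y
  proof -
    have bxy: "b x y > 0" using that by (simp add: adj_def)
    have le: "1/2 * (b x y * f x * f y * (\<psi> x * e n x / f x - \<psi> y * e n y / f y)\<^sup>2)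
        \<le> schroedinger_form b p (\<lambda>x. \<psi> x * e n x)" for n
    proof -
      have "(\<lambda>x. \<psi> x * e n x / f x) \<in> Cc UNIV"
        using Cc_mult[OF e_Cc, of "\<lambda>x. \<psi> x / f x" n] by (auto intro: Cc_mono)
      note edge_le_transformed_energy[OF graph fdom fpos this, of x y]
      moreover have "(\<Sum>\<^sub>\<infinity>x. schroedinger b p f x / f x * (\<psi> x * e n x)\<^sup>2) \<ge> 0"
        by (intro infsum_nonneg mult_nonneg_nonneg divide_nonneg_pos Hf fpos zero_le_power2)
      ultimately show ?thesis
        unfolding ground_state_representation[OF graph fdom fpos phi_Cc] by linarith
    qed
    have "1/2 * (b x y * f x * f y * (\<psi> x / f x - \<psi> y / f y)\<^sup>2) \<le> 0"
    proof (rule LIMSEQ_le[OF _ form_lim])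
      show "(\<lambda>n. 1/2 * (b x y * f x * f y * (\<psi> x * e n x / f x - \<psi> y * e n y / f y)\<^sup>2))
          \<longlonglongrightarrow> 1/2 * (b x y * f x * f y * (\<psi> x / f x - \<psi> y / f y)\<^sup>2)"
        using fpos[of x] fpos[of y] by (intro tendsto_intros phi_lim) auto
    qed (use le in blast)
    moreover have pos: "b x y * f x * f y > 0"
      using bxy fpos[of x] fpos[of y] by simp
    ultimately have "(b x y * f x * f y) * (\<psi> x / f x - \<psi> y / f y)\<^sup>2 \<le> (b x y * f x * f y) * 0"
      by simp
    then have "(\<psi> x / f x - \<psi> y / f y)\<^sup>2 \<le> 0"
      using pos by (simp only: mult_le_cancel_left_pos)
    then show ?thesis by simp
  qed
  \<comment> \<open>An arbitrary base vertex.\<close>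
  obtain x0 :: 'a where True by simp
  have const: "\<psi> x0 / f x0 = \<psi> x / f x" for x
  proof -
    have "(adj b)\<^sup>*\<^sup>* x0 x" using conn by (simp add: connected_graph_def)
    then show ?thesis
    proof (rule rtranclp_induct)
      show "\<psi> x0 / f x0 = \<psi> z / f z" if "\<psi> x0 / f x0 = \<psi> y / f y" "adj b y z" for y z
        using that(1) step[OF that(2)] by (rule trans)
    qed simp
  qed
  have "f x = f x0 / \<psi> x0 * \<psi> x" for x
    using const[of x] fpos[of x] fpos[of x0] pos[of x0] by (simp add: field_simps)
  then show ?thesis by blast
qed

text \<open>Only edges with an endpoint in \<open>W\<close> are affected. There the squared
  difference is at most 1, so the increase is at most the total weight in the rows and columns of
  \<open>W\<close>, which is finite and independent of \<open>n\<close>.\<close>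

lemma truncated_energy_bound:
  assumes "finite W"
  obtains B where
    "\<And>n. transformed_energy b \<psi> (\<lambda>x. of_bool (x \<notin> W) * e n x) \<le> transformed_energy b \<psi> (e n) + B"
proof -
  define k where "k x y = of_bool (x \<in> W) * (b x y * \<psi> x * \<psi> y)" for x y
  define s where "s = (\<Sum>x\<in>W. infsum (k x) UNIV)"
  have one: "((\<lambda>(x, y). k x y) has_sum s) UNIV"
    unfolding s_def
  proof (rule has_sum_finite_rows[OF assms])
    show "k x summable_on UNIV" for x
      unfolding k_def by (rule summable_on_cmult_right[OF weighted_formal_domainD[OF graph dom]])
  qed (simp add: k_def)
  have two: "((\<lambda>(x, y). k y x) has_sum s) UNIV"
    using has_sum_swap[where f = "\<lambda>(x, y). k x y" and A = UNIV and B = UNIV] one by simp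
  have three: "((\<lambda>(x, y). b x y * \<psi> x * \<psi> y * (e n x - e n y)\<^sup>2) has_sum transformed_energy b \<psi> (e n)) UNIV"
    for n unfolding transformed_energy_def
    by (rule has_sum_infsum[OF transformed_energy_summable[OF graph dom e_Cc]])
  define \<eta> where "\<eta> n x = of_bool (x \<notin> W) * e n x" for n x
  have \<eta>: "\<eta> n \<in> Cc UNIV" for n
    unfolding \<eta>_def using Cc_mult[OF e_Cc] by (rule Cc_mono) simp
  have "transformed_energy b \<psi> (\<eta> n) \<le> transformed_energy b \<psi> (e n) + (s + s)" for n
  proof (rule has_sum_mono[OF _ has_sum_add[OF three has_sum_add[OF one two]]])
    show "((\<lambda>(x, y). b x y * \<psi> x * \<psi> y * (\<eta> n x - \<eta> n y)\<^sup>2) has_sum transformed_energy b \<psi> (\<eta> n)) UNIV"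
      unfolding transformed_energy_def
      by (rule has_sum_infsum[OF transformed_energy_summable[OF graph dom \<eta>]])
    fix z :: "'a \<times> 'a"
    obtain x y where z: "z = (x, y)" by (cases z)
    have c: "b x y * \<psi> x * \<psi> y \<ge> 0" "b y x * \<psi> y * \<psi> x = b x y * \<psi> x * \<psi> y"
      using graph_overD(2)[OF graph, of x y] graph_overD(1)[OF graph, of x y] pos[of x] pos[of y] by simp_all
    have "(\<eta> n x - \<eta> n y)\<^sup>2 \<le> 1" if "x \<in> W \<or> y \<in> W"
      using that e_ge[of n x] e_ge[of n y] e_le[of n x] e_le[of n y]
      by (auto simp: \<eta>_def abs_square_le_1)
    then have "(\<eta> n x - \<eta> n y)\<^sup>2 \<le> (e n x - e n y)\<^sup>2 + (of_bool (x \<in> W) + of_bool (y \<in> W))"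
      by (cases "x \<in> W \<or> y \<in> W") (auto simp: \<eta>_def intro: order_trans)
    from mult_left_mono[OF this c(1)] show "(case z of (x, y) \<Rightarrow> b x y * \<psi> x * \<psi> y * (\<eta> n x - \<eta> n y)\<^sup>2) \<le>
        (case z of (x, y) \<Rightarrow> b x y * \<psi> x * \<psi> y * (e n x - e n y)\<^sup>2) +
        ((case z of (x, y) \<Rightarrow> k x y) + (case z of (x, y) \<Rightarrow> k y x))"
      unfolding z k_def prod.case c(2) by (simp add: algebra_simps)
  qed
  then show ?thesis using that[of "s + s"] unfolding \<eta>_def by blast
qed

text \<open>Testing with \<open>\<psi> x * e n x\<close> cut off on \<open>W\<close> and letting
  \<open>n\<close> tend to infinity bounds the sum of \<open>w x * (\<psi> x)\<^sup>2\<close> over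
  any finite set off \<open>W\<close> by \<open>B / (2 * \<mu>)\<close>. This would make the whole
  sum finite.\<close>

lemma optimal_off_finite:
  assumes w: "\<And>x. w x \<ge> 0" and null: "\<not> (\<lambda>x. w x * (\<psi> x)\<^sup>2) summable_on UNIV"
    and W: "finite W" and \<mu>: "\<mu> > 0"
  shows "\<exists>\<phi>\<in>Cc (UNIV - W). schroedinger_form b p \<phi> < \<mu> * pot_form w \<phi>"
proof (rule ccontr)
  assume "\<not> ?thesis"
  then have le: "\<mu> * pot_form w \<phi> \<le> schroedinger_form b p \<phi>" if "\<phi> \<in> Cc (UNIV - W)" for \<phi>
    using that by force
  obtain B where B: "\<And>n. transformed_energy b \<psi> (\<lambda>x. of_bool (x \<notin> W) * e n x)
      \<le> transformed_energy b \<psi> (e n) + B"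
    using truncated_energy_bound[OF W] by blast
  \<comment> \<open>The 0 in \<open>1/2 * (0 + B)\<close> is the limit of the energies.\<close>
  have bound: "\<mu> * (\<Sum>x\<in>F. w x * (\<psi> x)\<^sup>2) \<le> 1/2 * (0 + B)" if F: "finite F" "F \<inter> W = {}" for F
  proof (rule LIMSEQ_le)
    show "(\<lambda>n. \<mu> * (\<Sum>x\<in>F. w x * (\<psi> x * e n x)\<^sup>2)) \<longlonglongrightarrow> \<mu> * (\<Sum>x\<in>F. w x * (\<psi> x)\<^sup>2)"
      by (intro tendsto_intros phi_lim)
    show "(\<lambda>n. 1/2 * (transformed_energy b \<psi> (e n) + B)) \<longlonglongrightarrow> 1/2 * (0 + B)"
      by (intro tendsto_intros energy_lim)
    have "\<mu> * (\<Sum>x\<in>F. w x * (\<psi> x * e n x)\<^sup>2) \<le> 1/2 * (transformed_energy b \<psi> (e n) + B)" for n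
    proof -
      define \<eta> where "\<eta> x = of_bool (x \<notin> W) * e n x" for x
      have \<eta>: "\<eta> \<in> Cc {x. of_bool (x \<notin> W) \<noteq> (0::real)}"
        unfolding \<eta>_def by (rule Cc_mult[OF e_Cc])
      then have \<eta>': "\<eta> \<in> Cc UNIV" by (rule Cc_mono) simp
      have "(\<lambda>x. \<psi> x * \<eta> x) \<in> Cc (UNIV - W)"
        using Cc_mult[OF \<eta>', of \<psi>] by (auto simp: Cc_def \<eta>_def)
      note le' = le[OF this] and sum_le_pot_form[OF this w F(1)]
      have "(\<Sum>x\<in>F. w x * (\<psi> x * e n x)\<^sup>2) = (\<Sum>x\<in>F. w x * (\<psi> x * \<eta> x)\<^sup>2)"
        using F(2) by (intro sum.cong) (auto simp: \<eta>_def)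
      also have "\<dots> \<le> pot_form w (\<lambda>x. \<psi> x * \<eta> x)" by fact
      finally have "\<mu> * (\<Sum>x\<in>F. w x * (\<psi> x * e n x)\<^sup>2) \<le> \<mu> * pot_form w (\<lambda>x. \<psi> x * \<eta> x)"
        using \<mu> by (intro mult_left_mono) auto
      also have "\<dots> \<le> schroedinger_form b p (\<lambda>x. \<psi> x * \<eta> x)" by (rule le')
      also have "\<dots> = 1/2 * transformed_energy b \<psi> \<eta>" by (rule form_eq[OF \<eta>'])
      finally show ?thesis using B[of n] unfolding \<eta>_def by simp
    qed
    then show "\<exists>N. \<forall>n\<ge>N. \<mu> * (\<Sum>x\<in>F. w x * (\<psi> x * e n x)\<^sup>2)
        \<le> 1/2 * (transformed_energy b \<psi> (e n) + B)" by blast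
  qed
  have "(\<lambda>x. w x * (\<psi> x)\<^sup>2) summable_on UNIV"
  proof (rule nonneg_bdd_above_summable_on)
    show "bdd_above (sum (\<lambda>x. w x * (\<psi> x)\<^sup>2) ` {F. F \<subseteq> UNIV \<and> finite F})"
    proof (rule bdd_aboveI2)
      fix F :: "'a set" assume "F \<in> {F. F \<subseteq> UNIV \<and> finite F}"
      then have F: "finite F" by simp
      have "(\<Sum>x\<in>F. w x * (\<psi> x)\<^sup>2) \<le> (\<Sum>x\<in>(F - W) \<union> W. w x * (\<psi> x)\<^sup>2)"
        using F W w by (intro sum_mono2) auto
      also have "\<dots> = (\<Sum>x\<in>F - W. w x * (\<psi> x)\<^sup>2) + (\<Sum>x\<in>W. w x * (\<psi> x)\<^sup>2)"
        using F W by (intro sum.union_disjoint) auto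
      also have "(\<Sum>x\<in>F - W. w x * (\<psi> x)\<^sup>2) \<le> B / (2 * \<mu>)"
        using bound[of "F - W"] F \<mu> by (auto simp: field_simps)
      finally show "(\<Sum>x\<in>F. w x * (\<psi> x)\<^sup>2) \<le> B / (2 * \<mu>) + (\<Sum>x\<in>W. w x * (\<psi> x)\<^sup>2)" by simp
    qed
  qed (use w in auto)
  with null show False by simp
qed

end

text \<open>Passes from failure of real summability to the extended sum in
  \<open>null_critical\<close>: a finite extended sum would bound all finite partial sums.\<close>

lemma ennreal_infsum_eq_infinity:
  assumes h: "\<And>x. h x \<ge> 0" and ns: "\<not> h summable_on UNIV"
  shows "(\<Sum>\<^sub>\<infinity>x. ennreal (h x)) = \<infinity>"
proof (rule ccontr)
  assume fin: "(\<Sum>\<^sub>\<infinity>x. ennreal (h x)) \<noteq> \<infinity>"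
  have "sum h F \<le> enn2real (\<Sum>\<^sub>\<infinity>x. ennreal (h x))" if "finite F" for F
  proof -
    have "ennreal (sum h F) = (\<Sum>x\<in>F. ennreal (h x))"
      using h by (intro sum_ennreal[symmetric]) auto
    also have "\<dots> \<le> (\<Sum>\<^sub>\<infinity>x. ennreal (h x))"
      unfolding infsum_finite[OF that, symmetric] by (intro infsum_mono_neutral nonneg_summable_on_complete) auto
    finally show ?thesis
      using fin h by (metis enn2real_ennreal enn2real_mono infinity_ennreal_def sum_nonneg top.not_eq_extremum)
  qed
  then have "h summable_on UNIV"
    using h by (intro nonneg_bdd_above_summable_on bdd_aboveI2) auto
  with ns show False by simp
qed

section \<open>Elementary comparison of logarithms and square roots\<close>

text \<open>This is \<open>ln z \<le> z - 1\<close> at \<open>z = sqrt s / sqrt t\<close>.\<close>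

lemma ln_diff_le_sqrt_diff:
  fixes s t :: real
  assumes "0 < t" "t \<le> s"
  shows "sqrt t * (ln s - ln t) \<le> 2 * (sqrt s - sqrt t)"
proof -
  have "ln s - ln t = 2 * ln (sqrt s / sqrt t)"
    using assms by (simp add: ln_div ln_sqrt)
  also have "\<dots> \<le> 2 * (sqrt s / sqrt t - 1)"
    using ln_le_minus_one[of "sqrt s / sqrt t"] assms by simp
  finally have "sqrt t * (ln s - ln t) \<le> sqrt t * (2 * (sqrt s / sqrt t - 1))"
    using assms by (intro mult_left_mono) auto
  also have "\<dots> = 2 * (sqrt s - sqrt t)"
    using assms by (simp add: field_simps)
  finally show ?thesis .
qed

text \<open>The bound of the geometric by the logarithmic mean, with constant 2.\<close>

lemma sqrt_mult_ln_diff_le: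
  fixes s t :: real
  assumes "0 < t" "t \<le> s"
  shows "sqrt s * sqrt t * (ln s - ln t) \<le> 2 * (s - t)"
proof -
  have "sqrt s * sqrt t * (ln s - ln t) = sqrt s * (sqrt t * (ln s - ln t))"
    by (rule mult.assoc)
  also have "\<dots> \<le> sqrt s * (2 * (sqrt s - sqrt t))"
    using assms by (intro mult_left_mono ln_diff_le_sqrt_diff) auto
  also have "\<dots> = 2 * (sqrt s * sqrt s) - 2 * (sqrt s * sqrt t)"
    by (simp only: right_diff_distrib mult_ac)
  also have "\<dots> \<le> 2 * (sqrt s * sqrt s) - 2 * (sqrt t * sqrt t)"
    using assms mult_right_mono[of "sqrt t" "sqrt s" "sqrt t"] by simp
  also have "\<dots> = 2 * (s - t)" using assms by simp
  finally show ?thesis .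
qed

text \<open>The ratio bound gives \<open>sqrt s + sqrt t \<le> (1 + sqrt M) * sqrt t\<close>, and
  the factor \<open>sqrt t\<close> is what turns the logarithmic difference into a difference of
  roots.\<close>

lemma diff_mult_ln_diff_le:
  fixes s t :: real
  assumes "0 < t" "t \<le> s" "s \<le> M * t"
  shows "(s - t) * (ln s - ln t) \<le> 2 * (1 + sqrt M) * (sqrt s - sqrt t)\<^sup>2"
proof -
  have "sqrt s \<le> sqrt M * sqrt t"
    using assms(3) by (simp flip: real_sqrt_mult)
  then have s: "sqrt s + sqrt t \<le> (1 + sqrt M) * sqrt t" by (simp add: algebra_simps)
  have d: "0 \<le> sqrt s - sqrt t" "0 \<le> ln s - ln t" using assms by auto
  have "s - t = (sqrt s - sqrt t) * (sqrt s + sqrt t)"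
    using assms by (simp add: algebra_simps)
  then have "(s - t) * (ln s - ln t) = (sqrt s - sqrt t) * ((sqrt s + sqrt t) * (ln s - ln t))"
    by simp
  also have "\<dots> \<le> (sqrt s - sqrt t) * ((1 + sqrt M) * sqrt t * (ln s - ln t))"
    using d s by (intro mult_left_mono mult_right_mono) auto
  also have "\<dots> = (sqrt s - sqrt t) * ((1 + sqrt M) * (sqrt t * (ln s - ln t)))"
    by (simp only: mult.assoc)
  also have "\<dots> \<le> (sqrt s - sqrt t) * ((1 + sqrt M) * (2 * (sqrt s - sqrt t)))"
  proof -
    \<comment> \<open>\<open>sqrt\<close> is negative at negative arguments, so the sign of
      \<open>1 + sqrt M\<close> needs a lower bound on \<open>M\<close>.\<close>
    have "M \<ge> 1" using assms by (metis dual_order.trans mult_le_cancel_right1 not_less)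
    then show ?thesis
      using d assms(1,2) by (intro mult_left_mono ln_diff_le_sqrt_diff) auto
  qed
  finally show ?thesis by (simp only: power2_eq_square mult_ac)
qed

text \<open>Here \<delta> stands for an increment of a truncated logarithm. One factor \<delta> is
  replaced by the full logarithmic difference, which the geometric mean bound controls.\<close>

lemma sqrt_mult_square_le:
  assumes s: "0 < s" and t: "0 < t"
    and d: "0 \<le> (s - t) * \<delta>" "\<bar>\<delta>\<bar> \<le> \<bar>ln s - ln t\<bar>"
  shows "sqrt s * sqrt t * \<delta>\<^sup>2 \<le> 2 * ((s - t) * \<delta>)"
proof -
  have main: "sqrt s * sqrt t * \<delta>\<^sup>2 \<le> 2 * ((s - t) * \<delta>)"
    if st: "0 < t" "t \<le> s" and d: "0 \<le> \<delta>" "\<delta> \<le> ln s - ln t" for s t \<delta> :: real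
  proof -
    have "sqrt s * sqrt t * \<delta> \<le> sqrt s * sqrt t * (ln s - ln t)"
      using st d by (intro mult_left_mono) auto
    also have "\<dots> \<le> 2 * (s - t)" by (rule sqrt_mult_ln_diff_le[OF st])
    finally have "sqrt s * sqrt t * \<delta> * \<delta> \<le> 2 * (s - t) * \<delta>"
      using d by (intro mult_right_mono)
    then show ?thesis by (simp only: power2_eq_square mult.assoc)
  qed
  consider "s = t" | "t < s" | "s < t" by linarith
  then show ?thesis
  proof cases
    case 1
    then show ?thesis using d by simp
  next
    case 2
    then have "0 \<le> \<delta>" "ln t \<le> ln s" using d(1) t by (auto simp: zero_le_mult_iff)
    then show ?thesis using main[of t s \<delta>] 2 d t by auto
  next
    case 3
    then have "\<delta> \<le> 0" "ln s \<le> ln t" using d(1) s by (auto simp: zero_le_mult_iff)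
    then show ?thesis using main[of s t "- \<delta>"] 3 d s by (auto simp: algebra_simps)
  qed
qed

section \<open>The ratio of two superharmonic functions and its flux\<close>

text \<open>In the application \<open>f / g = u0 / (1 - u0)\<close>: condition (a) becomes
  \<open>proper\<close> and \<open>unbounded\<close>, condition (b) becomes
  \<open>ratio\<close>.\<close>

locale superharmonic_pair =
  fixes b :: "'a \<Rightarrow> 'a \<Rightarrow> real" and q f g :: "'a \<Rightarrow> real" and K :: "'a set" and M :: real
  assumes graph: "graph_over b" and conn: "connected_graph b"
    and f_pos: "f x > 0" and g_pos: "g x > 0"
    and f_dom: "f \<in> formal_domain b" and g_dom: "g \<in> formal_domain b"
    and Hf: "schroedinger b q f x \<ge> 0" and Hg: "schroedinger b q g x \<ge> 0"
    and finite_K: "finite K"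
    and Hf_off: "x \<notin> K \<Longrightarrow> schroedinger b q f x = 0"
    and Hg_off: "x \<notin> K \<Longrightarrow> schroedinger b q g x = 0"
    and proper: "0 < s \<Longrightarrow> finite {x. s \<le> f x / g x \<and> f x / g x \<le> t}"
    and unbounded: "\<exists>x. f x / g x > t"
    and M_pos: "M > 0"
    and ratio: "adj b x y \<Longrightarrow> f x / g x \<le> M * (f y / g y)"
begin

definition "r x = f x / g x"

definition "c x y = b x y * g x * g y"

definition "\<psi> x = sqrt (f x) * sqrt (g x)"

definition "w x = schroedinger b q \<psi> x / \<psi> x"

text \<open>A discrete Wronskian; it will be the Laplacian of \<open>r\<close> for the weights
  \<open>c\<close>.\<close>

definition "\<rho> x = g x * schroedinger b q f x - f x * schroedinger b q g x"

definition "lev s x = (of_bool (r x > s) :: real)"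

text \<open>Summing over ordered pairs counts each edge crossing the level twice. All terms are
  nonnegative, since \<open>lev s\<close> increases with \<open>r\<close>.\<close>

definition "flux s = (\<Sum>\<^sub>\<infinity>(x, y)\<in>UNIV. c x y * (r x - r y) * (lev s x - lev s y))"

lemma r_pos: "r x > 0" using f_pos[of x] g_pos[of x] by (simp add: r_def)

lemma psi_pos: "\<psi> x > 0" using f_pos[of x] g_pos[of x] by (simp add: \<psi>_def)

lemma c_nonneg: "c x y \<ge> 0"
  using graph_overD(2)[OF graph, of x y] g_pos[of x] g_pos[of y] by (simp add: c_def)

lemma c_sym: "c x y = c y x"
  using graph_overD(1)[OF graph, of x y] by (simp add: c_def)

lemma c_pos_iff: "c x y > 0 \<longleftrightarrow> adj b x y"
  using g_pos[of x] g_pos[of y] by (simp add: c_def adj_def zero_less_mult_iff)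

lemma \<rho>_off: "x \<notin> K \<Longrightarrow> \<rho> x = 0" by (simp add: \<rho>_def Hf_off Hg_off)

text \<open>\<open>c x y * (r x - r y)\<close> is \<open>b x y * (f x * g y - f y * g x)\<close>, a
  combination of the Laplacian terms of \<open>f\<close> and \<open>g\<close> in which
  \<open>q\<close> cancels. With \<open>\<rho>_off\<close>, this makes \<open>r\<close> harmonic off
  \<open>K\<close>.\<close>

lemma c_row: "((\<lambda>y. c x y * (r x - r y)) has_sum \<rho> x) UNIV"
proof -
  have "((\<lambda>y. g x * (b x y * (f x - f y)) + (- f x) * (b x y * (g x - g y))) has_sum
      (g x * laplacian b f x + (- f x) * laplacian b g x)) UNIV"
    unfolding laplacian_def
    by (intro has_sum_add has_sum_cmult_right has_sum_infsum formal_domainD(2)[OF graph] f_dom g_dom)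
  moreover have "g x * (b x y * (f x - f y)) + (- f x) * (b x y * (g x - g y)) = c x y * (r x - r y)" for y
    using g_pos[of x] g_pos[of y] by (simp add: c_def r_def field_simps)
  moreover have "g x * laplacian b f x + (- f x) * laplacian b g x = \<rho> x"
    by (simp add: \<rho>_def schroedinger_def algebra_simps)
  ultimately show ?thesis by (simp only:)
qed

lemma lev_term_nonneg: "c x y * (r x - r y) * (lev s x - lev s y) \<ge> 0"
proof -
  have "(r x - r y) * (lev s x - lev s y) \<ge> 0" by (simp add: lev_def)
  then show ?thesis using c_nonneg[of x y] by (simp add: mult.assoc)
qed

text \<open>By the ratio bound, every edge crossing the level \<open>s\<close> has its lower endpoint in the finite set
  \<open>{s / M \<le> r \<le> s}\<close>.\<close>

lemma lev_summable:
  assumes s: "s > 0"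
  shows "(\<lambda>(x, y). c x y * (r x - r y) * (lev s x - lev s y)) summable_on UNIV"
proof -
  define S where "S = {x. s / M \<le> r x \<and> r x \<le> s}"
  have fS: "finite S" unfolding S_def r_def using s M_pos by (intro proper) simp
  define k where "k x y = of_bool (x \<in> S) * \<bar>c x y * (r x - r y)\<bar>" for x y
  have k: "(\<lambda>(x, y). k x y) summable_on UNIV"
  proof (rule has_sum_imp_summable, rule has_sum_finite_rows[OF fS])
    show "k x summable_on UNIV" for x
      unfolding k_def
      by (intro summable_on_cmult_right
        summable_on_iff_abs_summable_on_real[THEN iffD1, unfolded real_norm_def]
        has_sum_imp_summable[OF c_row])
  qed (simp add: k_def)
  moreover have "(\<lambda>(x, y). k y x) summable_on UNIV"
    using summable_on_swap[where f = "\<lambda>(x, y). k x y" and A = UNIV and B = UNIV] k by simp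
  ultimately have kk: "(\<lambda>z. (case z of (x, y) \<Rightarrow> k x y) + (case z of (x, y) \<Rightarrow> k y x)) summable_on UNIV"
    by (rule summable_on_add)
  show ?thesis
  proof (rule summable_on_comparison_test[OF kk])
    fix z :: "'a \<times> 'a"
    obtain x y where z: "z = (x, y)" by (cases z)
    have "c x y * (r x - r y) * (lev s x - lev s y) \<le> k x y + k y x"
    proof (cases "c x y = 0 \<or> lev s x = lev s y")
      case True
      then show ?thesis by (auto simp: k_def)
    next
      case False
      then have "c x y > 0" using c_nonneg[of x y] by simp
      then have "adj b x y" "adj b y x" using c_pos_iff[of x y] c_pos_iff[of y x] c_sym[of x y] by auto
      then have "r x \<le> M * r y" "r y \<le> M * r x" using ratio by (auto simp: r_def)
      then have "x \<in> S \<or> y \<in> S"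
        using False M_pos by (auto simp: S_def lev_def field_simps split: if_splits)
      moreover have "\<bar>c y x * (r y - r x)\<bar> = \<bar>c x y * (r x - r y)\<bar>"
        by (simp add: c_sym[of y x] abs_mult abs_minus_commute)
      ultimately have "\<bar>c x y * (r x - r y)\<bar> \<le> k x y + k y x"
        by (auto simp: k_def)
      moreover have "\<bar>lev s x - lev s y\<bar> \<le> 1" by (simp add: lev_def)
      then have "\<bar>c x y * (r x - r y) * (lev s x - lev s y)\<bar> \<le> \<bar>c x y * (r x - r y)\<bar> * 1"
        unfolding abs_mult[of _ "lev s x - lev s y"] by (intro mult_left_mono) auto
      ultimately show ?thesis by linarith
    qed
    then show "(case z of (x, y) \<Rightarrow> c x y * (r x - r y) * (lev s x - lev s y))
        \<le> (case z of (x, y) \<Rightarrow> k x y) + (case z of (x, y) \<Rightarrow> k y x)"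
      by (simp add: z)
    show "0 \<le> (case z of (x, y) \<Rightarrow> c x y * (r x - r y) * (lev s x - lev s y))"
      using lev_term_nonneg by (simp add: z)
  qed
qed

lemma flux_ge_edge:
  assumes "s > 0"
  shows "c x y * (r x - r y) * (lev s x - lev s y) \<le> flux s"
proof -
  have "(\<Sum>(x, y)\<in>{(x, y)}. c x y * (r x - r y) * (lev s x - lev s y)) \<le> flux s"
    unfolding flux_def using lev_term_nonneg
    by (intro finite_sum_le_infsum lev_summable assms) auto
  then show ?thesis by simp
qed

text \<open>Integration by parts for a \<open>D\<close> that need not have finite support:
  \<open>m\<close> drops out of the differences, the jump \<open>k * lev s x\<close> yields the
  flux, and Green's formula handles the finitely supported \<open>T\<close>.\<close>

lemma level_identity:
  assumes s: "s > 0" and S: "finite S" and T: "\<And>x. x \<notin> S \<Longrightarrow> T x = 0"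
    and D: "\<And>x. D x = k * lev s x + m - T x"
  shows "((\<lambda>(x, y). c x y * (r x - r y) * (D x - D y)) has_sum
    (k * flux s - 2 * (\<Sum>x\<in>S. T x * \<rho> x))) UNIV"
proof -
  have lap: "laplacian c r x = \<rho> x" for x
    unfolding laplacian_def by (rule infsumI[OF c_row])
  have 1: "((\<lambda>(x, y). c x y * (r x - r y) * (T x - T y)) has_sum 2 * (\<Sum>x\<in>S. T x * \<rho> x)) UNIV"
    using green_formula[OF c_sym has_sum_imp_summable[OF c_row] S T] by (simp add: lap)
  have 2: "((\<lambda>(x, y). c x y * (r x - r y) * (lev s x - lev s y)) has_sum flux s) UNIV"
    unfolding flux_def by (rule has_sum_infsum[OF lev_summable[OF s]])
  have "((\<lambda>z. k * (case z of (x, y) \<Rightarrow> c x y * (r x - r y) * (lev s x - lev s y))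
      + - (case z of (x, y) \<Rightarrow> c x y * (r x - r y) * (T x - T y))) has_sum
      (k * flux s + - (2 * (\<Sum>x\<in>S. T x * \<rho> x)))) UNIV"
    by (intro has_sum_add has_sum_cmult_right 1 2 has_sum_uminusI)
  then show ?thesis
    by (simp add: case_prod_unfold D algebra_simps)
qed

end

section \<open>The function \<psi> and the Hardy weight\<close>

context superharmonic_pair
begin

lemma psi_eq: "\<psi> x = g x * sqrt (r x)"
proof -
  have "\<psi> x = sqrt ((g x)\<^sup>2 * r x)"
    using g_pos[of x] by (simp add: \<psi>_def r_def power2_eq_square flip: real_sqrt_mult)
  then show ?thesis using g_pos[of x] by (simp add: real_sqrt_mult)
qed

text \<open>Links the energy transformed by \<psi> to the weights \<open>c\<close>, for which
  \<open>r\<close> is harmonic off \<open>K\<close>.\<close>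

lemma weight_psi: "b x y * \<psi> x * \<psi> y = c x y * (sqrt (r x) * sqrt (r y))"
  by (simp add: psi_eq c_def)

text \<open>By the inequality of arithmetic and geometric means, \<open>f + g\<close> dominates
  \<psi>.\<close>

lemma psi_dom: "\<psi> \<in> formal_domain b"
proof (rule formal_domainI[OF graph])
  fix x
  have "(\<lambda>y. b x y * f y + b x y * g y) summable_on UNIV"
    by (intro summable_on_add formal_domainD(1)[OF graph] f_dom g_dom)
  then show "(\<lambda>y. b x y * \<psi> y) summable_on UNIV"
  proof (rule summable_on_comparison_test)
    fix y
    have "\<psi> y \<le> f y + g y"
      using arith_geo_mean_sqrt[of "f y" "g y"] f_pos[of y] g_pos[of y]
      by (simp add: \<psi>_def real_sqrt_mult)
    then show "b x y * \<psi> y \<le> b x y * f y + b x y * g y"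
      using graph_overD(2)[OF graph, of x y] by (simp flip: distrib_left add: mult_left_mono)
    show "0 \<le> b x y * \<psi> y"
      using graph_overD(2)[OF graph, of x y] psi_pos[of y] by simp
  qed
qed

text \<open>The square expands to \<open>f y / f x + g y / g x - 2 * (\<psi> y / \<psi> x)\<close>,
  so its sum combines the quotients \<open>L f / f\<close>, \<open>L g / g\<close> and
  \<open>L \<psi> / \<psi>\<close>; the constants and the potential cancel. Both
  \<open>w \<ge> 0\<close> and the formula for \<open>w\<close> follow.\<close>

lemma weight_has_sum:
  "((\<lambda>y. b x y * (sqrt (f y / f x) - sqrt (g y / g x))\<^sup>2) has_sum
    (2 * w x - schroedinger b q f x / f x - schroedinger b q g x / g x)) UNIV"
proof -
  have *: "((\<lambda>y. (2 / \<psi> x) * (b x y * (\<psi> x - \<psi> y)) +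
        ((- 1 / f x) * (b x y * (f x - f y)) + (- 1 / g x) * (b x y * (g x - g y)))) has_sum
      ((2 / \<psi> x) * laplacian b \<psi> x +
        ((- 1 / f x) * laplacian b f x + (- 1 / g x) * laplacian b g x))) UNIV"
    unfolding laplacian_def
    by (intro has_sum_add has_sum_cmult_right has_sum_infsum formal_domainD(2)[OF graph]
      f_dom g_dom psi_dom)
  have "(2 / \<psi> x) * (b x y * (\<psi> x - \<psi> y)) +
      ((- 1 / f x) * (b x y * (f x - f y)) + (- 1 / g x) * (b x y * (g x - g y))) =
      b x y * (sqrt (f y / f x) - sqrt (g y / g x))\<^sup>2" for y
  proof -
    have "(sqrt (f y / f x) - sqrt (g y / g x))\<^sup>2 =
        f y / f x + g y / g x - 2 * (sqrt (f y / f x) * sqrt (g y / g x))"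
      using f_pos[of x] f_pos[of y] g_pos[of x] g_pos[of y] by (simp add: power2_diff)
    also have "sqrt (f y / f x) * sqrt (g y / g x) = \<psi> y / \<psi> x"
      by (simp add: \<psi>_def real_sqrt_divide)
    finally have "b x y * (sqrt (f y / f x) - sqrt (g y / g x))\<^sup>2 =
        b x y * (f y / f x + g y / g x - 2 * (\<psi> y / \<psi> x))" by simp
    also have "\<dots> = (2 / \<psi> x) * (b x y * (\<psi> x - \<psi> y)) +
        ((- 1 / f x) * (b x y * (f x - f y)) + (- 1 / g x) * (b x y * (g x - g y)))"
      using f_pos[of x] g_pos[of x] psi_pos[of x] by (simp add: field_simps)
    finally show ?thesis by (rule sym)
  qed
  moreover have "(2 / \<psi> x) * laplacian b \<psi> x +
      ((- 1 / f x) * laplacian b f x + (- 1 / g x) * laplacian b g x) =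
      2 * w x - schroedinger b q f x / f x - schroedinger b q g x / g x"
    using f_pos[of x] g_pos[of x] psi_pos[of x]
    by (simp add: w_def schroedinger_def field_simps)
  ultimately show ?thesis using * by (simp only:)
qed

lemma weight_nonneg: "w x \<ge> 0"
proof -
  have "0 \<le> 2 * w x - schroedinger b q f x / f x - schroedinger b q g x / g x"
    by (rule has_sum_nonneg[OF weight_has_sum]) (simp add: graph_overD(2)[OF graph])
  moreover have "schroedinger b q f x / f x \<ge> 0" "schroedinger b q g x / g x \<ge> 0"
    using Hf Hg f_pos g_pos by (simp_all add: divide_nonneg_pos)
  ultimately show ?thesis by linarith
qed

lemma weight_formula:
  assumes "schroedinger b q f x = 0" and "schroedinger b q g x = 0"
  shows "w x = 1/2 * (\<Sum>\<^sub>\<infinity>y. b x y * (sqrt (f y / f x) - sqrt (g y / g x))\<^sup>2)"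
  using infsumI[OF weight_has_sum, of x] assms by simp

lemma psi_harmonic: "schroedinger b (\<lambda>x. q x - w x) \<psi> x = 0"
proof -
  have "schroedinger b q \<psi> x = w x * \<psi> x" using psi_pos[of x] by (simp add: w_def)
  then show ?thesis by (simp add: schroedinger_def algebra_simps)
qed

section \<open>Logarithmic cutoffs\<close>

definition "log_trunc N x = max (- real N) (min (real N) (ln (r x)))"
text \<open>\<open>Suc n\<close> keeps the divisor positive at \<open>n = 0\<close>. The value is 1
  where \<open>r x = 1\<close> and 0 once \<open>\<bar>ln (r x)\<bar>\<close> reaches
  \<open>n + 1\<close>.\<close>

definition "cutoff n x = 1 - \<bar>log_trunc (Suc n) x\<bar> / real (Suc n)"

lemma finite_level: "0 < s \<Longrightarrow> finite {x. s \<le> r x \<and> r x \<le> t}"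
  unfolding r_def by (rule proper)

text \<open>Up to a constant, the truncated logarithm is a jump of height \<open>2 * N\<close> at
  level 1 minus a finitely supported function bounded by \<open>N\<close>. The latter is paired with
  \<rho>, which lives on \<open>K\<close>, so both contributions are at most linear in
  \<open>N\<close>.\<close>

lemma log_trunc_energy:
  obtains C where "\<And>n. (\<lambda>(x, y). c x y * (r x - r y) * (log_trunc (Suc n) x - log_trunc (Suc n) y)) summable_on UNIV"
    and "\<And>n. (\<Sum>\<^sub>\<infinity>(x, y)\<in>UNIV. c x y * (r x - r y) * (log_trunc (Suc n) x - log_trunc (Suc n) y))
      \<le> real (Suc n) * C"
proof
  fix n
  define N where "N = real (Suc n)"
  have N: "N > 0" by (simp add: N_def)
  have tr: "log_trunc (Suc n) x = max (- N) (min N (ln (r x)))" for x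
    by (simp only: log_trunc_def N_def)
  \<comment> \<open>Height \<open>2 * N\<close> and shift \<open>- N\<close> reproduce both
    saturated values of the truncation, so \<open>T\<close> vanishes off \<open>S\<close>.\<close>
  define T where "T x = 2 * N * lev 1 x + (- N) - log_trunc (Suc n) x" for x
  define S where "S = {x. exp (- N) \<le> r x \<and> r x \<le> exp N}"
  have fS: "finite S" unfolding S_def by (rule finite_level) simp
  have T0: "T x = 0" if "x \<notin> S" for x
  proof -
    from that consider "r x < exp (- N)" | "exp N < r x" by (auto simp: S_def)
    then show ?thesis
    proof cases
      case 1
      then have "ln (r x) < - N" using r_pos[of x] by (metis ln_exp ln_less_cancel_iff exp_gt_zero)
      moreover have "r x < 1" using 1 N by (smt (verit) exp_le_one_iff)
      ultimately show ?thesis using N by (simp add: T_def tr lev_def)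
    next
      case 2
      then have "ln (r x) > N" using r_pos[of x] by (metis ln_exp ln_less_cancel_iff exp_gt_zero)
      moreover have "r x > 1" using 2 N by (smt (verit) one_le_exp_iff)
      ultimately show ?thesis using N by (simp add: T_def tr lev_def)
    qed
  qed
  have T_le: "\<bar>T x\<bar> \<le> N" for x
  proof (cases "r x > 1")
    case True
    then have "ln (r x) > 0" by simp
    moreover have "T x = N - max (- N) (min N (ln (r x)))" using True by (simp add: T_def tr lev_def)
    ultimately show ?thesis using N by linarith
  next
    case False
    then have "ln (r x) \<le> 0" using r_pos[of x] by simp
    moreover have "T x = - N - max (- N) (min N (ln (r x)))" using False by (simp add: T_def tr lev_def)
    ultimately show ?thesis using N by linarith
  qed
  have id: "((\<lambda>(x, y). c x y * (r x - r y) * (log_trunc (Suc n) x - log_trunc (Suc n) y)) has_sum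
      (2 * N * flux 1 - 2 * (\<Sum>x\<in>S. T x * \<rho> x))) UNIV"
    by (rule level_identity[OF _ fS T0, where m = "- N"]) (auto simp: T_def)
  then show "(\<lambda>(x, y). c x y * (r x - r y) * (log_trunc (Suc n) x - log_trunc (Suc n) y)) summable_on UNIV"
    by (rule has_sum_imp_summable)
  have "\<bar>\<Sum>x\<in>S. T x * \<rho> x\<bar> \<le> (\<Sum>x\<in>S. \<bar>T x * \<rho> x\<bar>)" by (rule sum_abs)
  also have "\<dots> \<le> (\<Sum>x\<in>S. N * \<bar>\<rho> x\<bar>)"
    unfolding abs_mult by (intro sum_mono mult_right_mono T_le) auto
  also have "\<dots> = (\<Sum>x\<in>S \<inter> K. N * \<bar>\<rho> x\<bar>)"
    using fS \<rho>_off by (intro sum.mono_neutral_right) auto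
  also have "\<dots> \<le> (\<Sum>x\<in>K. N * \<bar>\<rho> x\<bar>)"
    using finite_K N by (intro sum_mono2) auto
  also have "\<dots> = N * (\<Sum>x\<in>K. \<bar>\<rho> x\<bar>)" by (rule sum_distrib_left[symmetric])
  finally have "2 * N * flux 1 - 2 * (\<Sum>x\<in>S. T x * \<rho> x) \<le> N * (2 * (flux 1 + (\<Sum>x\<in>K. \<bar>\<rho> x\<bar>)))"
    by (simp add: algebra_simps)
  then show "(\<Sum>\<^sub>\<infinity>(x, y)\<in>UNIV. c x y * (r x - r y) * (log_trunc (Suc n) x - log_trunc (Suc n) y))
      \<le> real (Suc n) * (2 * (flux 1 + (\<Sum>x\<in>K. \<bar>\<rho> x\<bar>)))"
    unfolding infsumI[OF id] N_def .
qed

lemma cutoff_bounds: "0 \<le> cutoff n x" "cutoff n x \<le> 1"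
proof -
  have "\<bar>log_trunc (Suc n) x\<bar> \<le> real (Suc n)" unfolding log_trunc_def by linarith
  then show "0 \<le> cutoff n x" "cutoff n x \<le> 1" by (simp_all add: cutoff_def field_simps)
qed

lemma cutoff_Cc: "cutoff n \<in> Cc UNIV"
proof -
  have "exp (- real (Suc n)) \<le> r x \<and> r x \<le> exp (real (Suc n))" if "cutoff n x \<noteq> 0" for x
  proof -
    have "\<bar>log_trunc (Suc n) x\<bar> \<noteq> real (Suc n)" using that by (auto simp: cutoff_def)
    then have "- real (Suc n) \<le> ln (r x)" "ln (r x) \<le> real (Suc n)"
      unfolding log_trunc_def by linarith+
    then have "exp (- real (Suc n)) \<le> exp (ln (r x))" "exp (ln (r x)) \<le> exp (real (Suc n))"
      by (simp_all only: exp_le_cancel_iff)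
    then show ?thesis using r_pos[of x] by simp
  qed
  then have "{x. cutoff n x \<noteq> 0} \<subseteq> {x. exp (- real (Suc n)) \<le> r x \<and> r x \<le> exp (real (Suc n))}"
    by blast
  then show ?thesis
    using finite_level[of "exp (- real (Suc n))"] by (auto simp: Cc_def intro: finite_subset)
qed

lemma cutoff_lim: "(\<lambda>n. cutoff n x) \<longlonglongrightarrow> 1"
proof -
  have "(\<lambda>n. \<bar>log_trunc (Suc n) x\<bar> / real (Suc n)) \<longlonglongrightarrow> 0"
  proof (rule tendsto_sandwich[OF _ _ tendsto_const])
    show "(\<lambda>n. \<bar>ln (r x)\<bar> / real (Suc n)) \<longlonglongrightarrow> 0"
      by (rule LIMSEQ_Suc[OF lim_const_over_n])
    show "\<forall>\<^sub>F n in sequentially. \<bar>log_trunc (Suc n) x\<bar> / real (Suc n) \<le> \<bar>ln (r x)\<bar> / real (Suc n)"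
      by (intro always_eventually allI divide_right_mono) (auto simp: log_trunc_def)
  qed auto
  from tendsto_diff[OF tendsto_const this, of 1] show ?thesis by (simp add: cutoff_def)
qed

text \<open>Squaring the cutoff differences gives a factor \<open>1 / N\<^sup>2\<close> against the
  linear growth from \<open>log_trunc_energy\<close>.\<close>

lemma cutoff_energy_lim: "(\<lambda>n. transformed_energy b \<psi> (cutoff n)) \<longlonglongrightarrow> 0"
proof -
  obtain C where
    sm: "\<And>n. (\<lambda>(x, y). c x y * (r x - r y) * (log_trunc (Suc n) x - log_trunc (Suc n) y)) summable_on UNIV"
    and C: "\<And>n. (\<Sum>\<^sub>\<infinity>(x, y)\<in>UNIV. c x y * (r x - r y) * (log_trunc (Suc n) x - log_trunc (Suc n) y))
      \<le> real (Suc n) * C"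
    using log_trunc_energy by blast
  have le: "transformed_energy b \<psi> (cutoff n) \<le> 2 * C / real (Suc n)" for n
  proof -
    define N where "N = real (Suc n)"
    define D where "D = log_trunc (Suc n)"
    have N: "N > 0" by (simp add: N_def)
    have "b x y * \<psi> x * \<psi> y * (cutoff n x - cutoff n y)\<^sup>2
        \<le> 2 / N\<^sup>2 * (c x y * (r x - r y) * (D x - D y))" for x y
    proof -
      have "\<bar>cutoff n x - cutoff n y\<bar> = \<bar>\<bar>D y\<bar> - \<bar>D x\<bar>\<bar> / N"
        using N by (simp add: cutoff_def D_def N_def abs_divide flip: diff_divide_distrib)
      also have "\<dots> \<le> \<bar>D x - D y\<bar> / N"
        using N by (intro divide_right_mono) auto
      finally have "\<bar>cutoff n x - cutoff n y\<bar> \<le> \<bar>(D x - D y) / N\<bar>" using N by simp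
      then have "(cutoff n x - cutoff n y)\<^sup>2 \<le> ((D x - D y) / N)\<^sup>2"
        by (simp only: abs_le_square_iff)
      then have "sqrt (r x) * sqrt (r y) * (cutoff n x - cutoff n y)\<^sup>2
          \<le> sqrt (r x) * sqrt (r y) * (D x - D y)\<^sup>2 / N\<^sup>2"
        using r_pos[of x] r_pos[of y]
        by (simp add: power_divide mult_left_mono flip: times_divide_eq_right)
      also have "\<dots> \<le> 2 * ((r x - r y) * (D x - D y)) / N\<^sup>2"
      proof (intro divide_right_mono sqrt_mult_square_le r_pos)
        have mono: "ln (r x) \<le> ln (r y) \<Longrightarrow> D x \<le> D y" for x y
          by (auto simp: D_def log_trunc_def)
        show "0 \<le> (r x - r y) * (D x - D y)"
          using mono[of x y] mono[of y x] r_pos[of x] r_pos[of y]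
          by (cases "r x \<le> r y") (auto simp: zero_le_mult_iff)
        show "\<bar>D x - D y\<bar> \<le> \<bar>ln (r x) - ln (r y)\<bar>" by (auto simp: D_def log_trunc_def)
      qed auto
      finally have "c x y * (sqrt (r x) * sqrt (r y) * (cutoff n x - cutoff n y)\<^sup>2)
          \<le> c x y * (2 * ((r x - r y) * (D x - D y)) / N\<^sup>2)"
        by (rule mult_left_mono[OF _ c_nonneg])
      then show ?thesis
        unfolding weight_psi by (simp only: mult_ac times_divide_eq_right times_divide_eq_left)
    qed
    then have "transformed_energy b \<psi> (cutoff n) \<le>
        (\<Sum>\<^sub>\<infinity>z. 2 / N\<^sup>2 * (case z of (x, y) \<Rightarrow> c x y * (r x - r y) * (D x - D y)))"
      unfolding transformed_energy_def using sm[of n, folded D_def]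
      by (intro infsum_mono transformed_energy_summable[OF graph psi_dom cutoff_Cc]
        summable_on_cmult_right) auto
    also have "\<dots> = 2 / N\<^sup>2 * (\<Sum>\<^sub>\<infinity>(x, y)\<in>UNIV. c x y * (r x - r y) * (D x - D y))"
      by (rule infsum_cmult_right')
    also have "\<dots> \<le> 2 / N\<^sup>2 * (N * C)"
      using C[of n, folded D_def N_def] by (intro mult_left_mono) auto
    also have "\<dots> = 2 * C / N" using N by (simp add: power2_eq_square)
    finally show ?thesis unfolding N_def .
  qed
  show ?thesis
  proof (rule tendsto_sandwich[OF _ _ tendsto_const])
    show "(\<lambda>n. 2 * C / real (Suc n)) \<longlonglongrightarrow> 0" by (rule LIMSEQ_Suc[OF lim_const_over_n])
    show "\<forall>\<^sub>F n in sequentially. 0 \<le> transformed_energy b \<psi> (cutoff n)"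
      using transformed_energy_nonneg[OF graph, of \<psi>, OF psi_pos] by simp
  qed (use le in auto)
qed

sublocale null_sequence b "\<lambda>x. q x - w x" \<psi> cutoff
  by unfold_locales (rule graph conn psi_dom psi_pos psi_harmonic cutoff_Cc cutoff_bounds
    cutoff_lim cutoff_energy_lim)+

text \<open>If no edge crossed the level \<open>s\<close>, then \<open>r\<close> would be bounded by connectedness.\<close>

lemma positive_flux:
  obtains s where "s > 0" and "flux s > 0" and "\<And>x. x \<in> K \<Longrightarrow> r x \<le> s"
proof -
  obtain x0 :: 'a where True by simp
  \<comment> \<open>At this level all of \<open>K\<close> lies below or on it, so truncations above
    \<open>s\<close> do not see \<rho>. Inserting \<open>r x0\<close> covers empty \<open>K\<close>
    and provides a starting vertex not above the level.\<close>
  define s where "s = Max (insert (r x0) (r ` K))"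
  have s: "r x0 \<le> s" "\<And>x. x \<in> K \<Longrightarrow> r x \<le> s"
    unfolding s_def using finite_K by auto
  have "s > 0" using s(1) r_pos[of x0] by linarith
  obtain x1 where x1: "r x1 > s" using unbounded[of s] by (auto simp: r_def)
  have "\<exists>y z. adj b y z \<and> r y \<le> s \<and> r z > s"
  proof (rule ccontr)
    assume "\<not> ?thesis"
    then have step: "r z \<le> s" if "adj b y z" "r y \<le> s" for y z using that by force
    have "(adj b)\<^sup>*\<^sup>* x0 x1" using conn by (simp add: connected_graph_def)
    then have "r x1 \<le> s" by (rule rtranclp_induct) (auto intro: s(1) step)
    with x1 show False by simp
  qed
  then obtain y z where yz: "adj b y z" "r y \<le> s" "r z > s" by blast
  then have "0 < c z y * (r z - r y) * (lev s z - lev s y)"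
    using c_pos_iff[of y z] by (simp add: lev_def c_sym[of z y])
  also have "\<dots> \<le> flux s" by (rule flux_ge_edge[OF \<open>s > 0\<close>])
  finally show ?thesis using that[OF \<open>s > 0\<close>] s(2) by blast
qed

section \<open>Divergence of the weighted sum, and optimality\<close>

text \<open>A finite sum would give a bound on \<open>A * flux s\<close> that is uniform in the
  length \<open>A\<close> of a logarithmic truncation above \<open>s\<close>, although
  \<open>flux s > 0\<close>.\<close>

lemma not_summable: "\<not> (\<lambda>x. w x * (\<psi> x)\<^sup>2) summable_on UNIV"
proof
  assume sm: "(\<lambda>x. w x * (\<psi> x)\<^sup>2) summable_on UNIV"
  \<comment> \<open>The row sums obtained from \<open>weight_has_sum\<close>; superharmonicity of
    \<open>f\<close> and \<open>g\<close> bounds them by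
    \<open>2 * w x * (\<psi> x)\<^sup>2\<close>.\<close>
  define \<kappa> where "\<kappa> x = (\<psi> x)\<^sup>2 * (2 * w x - schroedinger b q f x / f x - schroedinger b q g x / g x)" for x
  have row: "((\<lambda>y. c x y * (sqrt (r x) - sqrt (r y))\<^sup>2) has_sum \<kappa> x) UNIV" for x
  proof -
    have "(\<psi> x)\<^sup>2 * (b x y * (sqrt (f y / f x) - sqrt (g y / g x))\<^sup>2) = c x y * (sqrt (r x) - sqrt (r y))\<^sup>2" for y
    proof -
      have "\<psi> x * (sqrt (f y / f x) - sqrt (g y / g x)) = sqrt (g x) * sqrt (f y) - sqrt (f x) * sqrt (g y)"
        using f_pos[of x] g_pos[of x] by (simp add: \<psi>_def real_sqrt_divide field_simps)
      also have "\<dots> = sqrt (g x) * sqrt (g y) * (sqrt (r y) - sqrt (r x))"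
        using g_pos[of x] g_pos[of y] by (simp add: r_def real_sqrt_divide field_simps)
      finally have "(\<psi> x * (sqrt (f y / f x) - sqrt (g y / g x)))\<^sup>2
          = (sqrt (g x) * sqrt (g y) * (sqrt (r y) - sqrt (r x)))\<^sup>2" by simp
      then show ?thesis
        using g_pos[of x] g_pos[of y]
        by (simp add: power_mult_distrib c_def power2_commute[of "sqrt (r y)"])
    qed
    with has_sum_cmult_right[OF weight_has_sum, of "(\<psi> x)\<^sup>2" x] show ?thesis
      by (simp only: \<kappa>_def)
  qed
  have "\<kappa> summable_on UNIV"
  proof (rule summable_on_comparison_test[OF summable_on_cmult_right[OF sm, of 2]])
    fix x
    have "(\<psi> x)\<^sup>2 * (2 * w x - schroedinger b q f x / f x - schroedinger b q g x / g x) \<le> (\<psi> x)\<^sup>2 * (2 * w x)"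
      using divide_nonneg_pos[OF Hf f_pos, of x x] divide_nonneg_pos[OF Hg g_pos, of x x]
      by (intro mult_left_mono) auto
    then show "\<kappa> x \<le> 2 * (w x * (\<psi> x)\<^sup>2)" by (simp add: \<kappa>_def mult_ac)
    show "0 \<le> \<kappa> x" by (rule has_sum_nonneg[OF row]) (simp add: c_nonneg)
  qed
  then have sm2: "(\<lambda>(x, y). c x y * (sqrt (r x) - sqrt (r y))\<^sup>2) summable_on UNIV"
    using summable_on_SigmaI[where f = "\<lambda>(x, y). c x y * (sqrt (r x) - sqrt (r y))\<^sup>2"
        and A = UNIV and B = "\<lambda>_. UNIV" and g = \<kappa>] row c_nonneg by simp
  define B where "B = 2 * (1 + sqrt M) * (\<Sum>\<^sub>\<infinity>(x, y)\<in>UNIV. c x y * (sqrt (r x) - sqrt (r y))\<^sup>2)"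
  obtain s where s: "s > 0" "flux s > 0" "\<And>x. x \<in> K \<Longrightarrow> r x \<le> s" by (rule positive_flux) blast
  have bound: "A * flux s \<le> B" if A: "A > 0" for A
  proof -
    \<comment> \<open>\<open>D\<close> is 0 up to level \<open>s\<close> and \<open>A\<close> beyond
      \<open>s * exp A\<close>, so it differs from a jump of height \<open>A\<close> at
      \<open>s\<close> only on a finite set.\<close>
    define D where "D x = max 0 (min A (ln (r x) - ln s))" for x
    define T where "T x = A * lev s x + 0 - D x" for x
    define S where "S = {x. s \<le> r x \<and> r x \<le> s * exp A}"
    have fS: "finite S" unfolding S_def by (rule finite_level[OF s(1)])
    have low: "T x = 0" if "r x \<le> s" for x
    proof -
      have "ln (r x) \<le> ln s" using that r_pos[of x] s(1) by simp
      then show ?thesis using that by (simp add: T_def D_def lev_def)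
    qed
    have T0: "T x = 0" if "x \<notin> S" for x
    proof (cases "r x \<le> s")
      case False
      then have "s * exp A < r x" using that by (auto simp: S_def)
      then have "ln (s * exp A) < ln (r x)" using s(1) r_pos[of x] by (subst ln_less_cancel_iff) auto
      then have "ln s + A < ln (r x)" using s(1) by (simp add: ln_mult)
      then show ?thesis using False A by (simp add: T_def D_def lev_def)
    qed (rule low)
    \<comment> \<open>\<open>T\<close> vanishes on \<open>K\<close> by the choice of
      \<open>s\<close>, and \<rho> vanishes off \<open>K\<close>.\<close>
    have "T x * \<rho> x = 0" for x
      using low[OF s(3), of x] \<rho>_off[of x] by (cases "x \<in> K") auto
    moreover have "((\<lambda>(x, y). c x y * (r x - r y) * (D x - D y)) has_sum
        A * flux s - 2 * (\<Sum>x\<in>S. T x * \<rho> x)) UNIV"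
      by (rule level_identity[OF s(1) fS T0, where m = 0]) (auto simp: T_def)
    ultimately have id: "((\<lambda>(x, y). c x y * (r x - r y) * (D x - D y)) has_sum A * flux s) UNIV"
      by (simp only: sum.neutral_const mult_zero_right diff_zero)
    have "A * flux s \<le> (\<Sum>\<^sub>\<infinity>z. 2 * (1 + sqrt M) * (case z of (x, y) \<Rightarrow> c x y * (sqrt (r x) - sqrt (r y))\<^sup>2))"
    proof (rule has_sum_mono[OF id has_sum_infsum])
      show "(\<lambda>z. 2 * (1 + sqrt M) * (case z of (x, y) \<Rightarrow> c x y * (sqrt (r x) - sqrt (r y))\<^sup>2)) summable_on UNIV"
        by (rule summable_on_cmult_right[OF sm2])
      have main: "c x y * ((r x - r y) * (D x - D y)) \<le> c x y * (2 * (1 + sqrt M) * (sqrt (r x) - sqrt (r y))\<^sup>2)"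
        if le: "r y \<le> r x" for x y
      proof (cases "c x y = 0")
        case False
        then have "adj b x y" using c_nonneg[of x y] c_pos_iff[of x y] by simp
        then have "r x \<le> M * r y" using ratio by (simp add: r_def)
        have "ln (r y) \<le> ln (r x)" using le r_pos[of x] r_pos[of y] by simp
        then have "D x - D y \<le> ln (r x) - ln (r y)" by (auto simp: D_def)
        then have "(r x - r y) * (D x - D y) \<le> (r x - r y) * (ln (r x) - ln (r y))"
          using le by (intro mult_left_mono) auto
        also have "\<dots> \<le> 2 * (1 + sqrt M) * (sqrt (r x) - sqrt (r y))\<^sup>2"
          by (rule diff_mult_ln_diff_le[OF r_pos le]) fact
        finally show ?thesis by (rule mult_left_mono[OF _ c_nonneg])
      qed simp
      fix z :: "'a \<times> 'a"
      obtain x y where z: "z = (x, y)" by (cases z)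
      have "c x y * ((r x - r y) * (D x - D y)) \<le> c x y * (2 * (1 + sqrt M) * (sqrt (r x) - sqrt (r y))\<^sup>2)"
      proof (cases "r y \<le> r x")
        case False
        then have "c y x * ((r y - r x) * (D y - D x)) \<le> c y x * (2 * (1 + sqrt M) * (sqrt (r y) - sqrt (r x))\<^sup>2)"
          by (intro main) simp
        moreover have "(r y - r x) * (D y - D x) = (r x - r y) * (D x - D y)" by (simp add: algebra_simps)
        ultimately show ?thesis by (simp only: c_sym[of y x] power2_commute[of "sqrt (r y)"])
      qed (rule main)
      then show "(case z of (x, y) \<Rightarrow> c x y * (r x - r y) * (D x - D y))
          \<le> 2 * (1 + sqrt M) * (case z of (x, y) \<Rightarrow> c x y * (sqrt (r x) - sqrt (r y))\<^sup>2)"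
        by (simp add: z mult_ac)
    qed
    also have "\<dots> = B" unfolding B_def by (rule infsum_cmult_right')
    finally show ?thesis .
  qed
  \<comment> \<open>This length gives \<open>2 * B \<le> B\<close>, while length 1 gives
    \<open>B \<ge> flux s > 0\<close>.\<close>
  have "max 1 (2 * B / flux s) * flux s \<le> B" by (rule bound) simp
  moreover have "1 * flux s \<le> B" by (rule bound) simp
  moreover have "2 * B / flux s * flux s \<le> max 1 (2 * B / flux s) * flux s"
    using s(2) by (intro mult_right_mono) auto
  ultimately show False using s(2) by simp
qed

lemma optimal: "optimal_hardy_weight b q w"
  unfolding optimal_hardy_weight_def
proof (intro conjI ballI)
  \<comment> \<open>For \<open>w = 0\<close> the divergent sum would be zero.\<close>
  have "\<exists>x. w x \<noteq> 0" by (rule ccontr) (use not_summable in simp)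
  then show "positive w" using weight_nonneg by (simp add: positive_def)
  show "schroedinger_form b q \<phi> - pot_form w \<phi> \<ge> 0" if "\<phi> \<in> Cc UNIV" for \<phi>
    unfolding schroedinger_form_minus_pot_form[OF that] by (rule form_nonneg[OF that])
  show crit: "critical b q w"
    unfolding critical_def
  proof
    assume "\<exists>w'. positive w' \<and>
      (\<forall>\<phi>\<in>Cc UNIV. schroedinger_form b q \<phi> - pot_form w \<phi> - pot_form w' \<phi> \<ge> 0)"
    then obtain w' where w': "positive w'"
      "\<And>\<phi>. \<phi> \<in> Cc UNIV \<Longrightarrow> schroedinger_form b q \<phi> - pot_form w \<phi> - pot_form w' \<phi> \<ge> 0"
      by blast
    from not_subcritical[OF w'(1)] obtain \<phi> where \<phi>:
      "\<phi> \<in> Cc UNIV" "schroedinger_form b (\<lambda>x. q x - w x) \<phi> < pot_form w' \<phi>" by blast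
    then show False
      using w'(2)[OF \<phi>(1)] schroedinger_form_minus_pot_form[OF \<phi>(1), of b q w] by linarith
  qed
  have "\<psi> x \<ge> 0 \<and> \<psi> x \<noteq> 0" for x using psi_pos[of x] by simp
  then have "positive \<psi>" by (simp add: positive_def)
  then have "ground_state b q w \<psi>"
    using superharmonic_unique psi_dom psi_harmonic
    by (auto simp: ground_state_def superharmonic_on_def)
  moreover have "(\<Sum>\<^sub>\<infinity>x. ennreal ((\<psi> x)\<^sup>2 * w x)) = \<infinity>"
    using not_summable weight_nonneg
    by (intro ennreal_infsum_eq_infinity) (auto simp: mult.commute)
  ultimately show "null_critical b q w" using crit by (auto simp: null_critical_def)
  show "optimal_near_infinity b q w"
    unfolding optimal_near_infinity_def
  proof (intro allI impI notI)
    fix \<mu> :: real and W :: "'a set"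
    assume "\<mu> > 0" "finite W"
    and le: "\<forall>\<phi>\<in>Cc (UNIV - W). schroedinger_form b q \<phi> - pot_form w \<phi> \<ge> \<mu> * pot_form w \<phi>"
    from optimal_off_finite[OF weight_nonneg not_summable \<open>finite W\<close> \<open>\<mu> > 0\<close>] obtain \<phi> where \<phi>:
      "\<phi> \<in> Cc (UNIV - W)" "schroedinger_form b (\<lambda>x. q x - w x) \<phi> < \<mu> * pot_form w \<phi>" by blast
    then show False
      using le[rule_format, OF \<phi>(1)] schroedinger_form_minus_pot_form[OF \<phi>(1), of b q w] by linarith
  qed
qed

end

section \<open>Reduction of the hypotheses on \<open>u\<close> and \<open>v\<close> to a
  superharmonic pair\<close>

theorem corollary1p3:
  fixes b :: "'a \<Rightarrow> 'a \<Rightarrow> real"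
    and q u v u0 w :: "'a \<Rightarrow> real"
  assumes "countable (UNIV :: 'a set)" and "infinite (UNIV :: 'a set)"
    and "graph_over b" and "connected_graph b"
    and "positive u" and "positive v" and "positive (\<lambda>x. v x - u x)"
    and "superharmonic_on b q UNIV u"
    and "superharmonic_on b q UNIV (\<lambda>x. v x - u x)"
    and "\<exists>K. finite K \<and> harmonic_on b q (UNIV - K) u \<and>
              harmonic_on b q (UNIV - K) (\<lambda>x. v x - u x)"
    and "u0 = (\<lambda>x. u x / v x)"
    and "proper_into {0<..<1} u0" and "(SUP x. u0 x) = 1"
    and "bdd_above {u0 x * (1 - u0 y) / (u0 y * (1 - u0 x)) | x y. adj b x y}"
    and "w = (\<lambda>x. schroedinger b q (\<lambda>y. sqrt (u y) * sqrt (v y - u y)) x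
                    / (sqrt (u x) * sqrt (v x - u x)))"
  shows "optimal_hardy_weight b q w \<and>
    (\<forall>x. schroedinger b q u x = 0 \<and> schroedinger b q v x = 0 \<longrightarrow>
       w x = 1/2 * (\<Sum>\<^sub>\<infinity>y. b x y *
               (sqrt (u y / u x) - sqrt ((v y - u y) / (v x - u x)))\<^sup>2))"
proof -
  define r where "r x = u x / (v x - u x)" for x
  have range: "0 < u0 x" "u0 x < 1" for x
    using assms(12) range_subsetD[of u0 "{0<..<1}" x] by (auto simp: proper_into_def)
  have ge: "u x \<ge> 0" "v x - u x \<ge> 0" for x
    using assms(5,7) by (auto simp: positive_def)
  \<comment> \<open>From \<open>0 < u / v\<close> and \<open>u \<ge> 0\<close> both \<open>u\<close>
    and \<open>v\<close> are positive, as division by zero yields 0; then \<open>u / v < 1\<close>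
    gives \<open>u < v\<close>.\<close>
  have pos: "u x > 0" "v x - u x > 0" for x
  proof -
    have "u x / v x > 0" "u x / v x < 1" using range[of x] by (auto simp: assms(11))
    then show "u x > 0" "v x - u x > 0" using ge[of x]
      by (auto simp: zero_less_divide_iff divide_less_eq_1)
  qed
  have u0: "u0 x = r x / (1 + r x)" and r: "r x > 0" "u0 x / (1 - u0 x) = r x" for x
    using pos[of x] by (simp_all add: assms(11) r_def field_simps)
  obtain K where K: "finite K" "harmonic_on b q (UNIV - K) u"
    "harmonic_on b q (UNIV - K) (\<lambda>x. v x - u x)"
    using assms(10) by blast
  obtain M where M: "\<And>x y. adj b x y \<Longrightarrow> u0 x * (1 - u0 y) / (u0 y * (1 - u0 x)) \<le> M"
    using assms(14) unfolding bdd_above_def by blast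
  \<comment> \<open>Taking \<open>max 1 M\<close> as the ratio constant makes its positivity
    immediate.\<close>
  interpret P: superharmonic_pair b q u "\<lambda>x. v x - u x" K "max 1 M"
  proof
    show "graph_over b" "connected_graph b" by fact+
    show "u x > 0" "v x - u x > 0" for x by (rule pos)+
    show "u \<in> formal_domain b" "(\<lambda>x. v x - u x) \<in> formal_domain b"
      using assms(8,9) by (auto simp: superharmonic_on_def)
    show "schroedinger b q u x \<ge> 0" "schroedinger b q (\<lambda>x. v x - u x) x \<ge> 0" for x
      using assms(8,9) by (auto simp: superharmonic_on_def)
    show "finite K" by fact
    show "schroedinger b q u x = 0" "schroedinger b q (\<lambda>x. v x - u x) x = 0" if "x \<notin> K" for x
      using K that by (auto simp: harmonic_on_def)
    show "max 1 M > 0" by simp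
    have mono: "s / (1 + s) \<le> t / (1 + t)" if "0 < s" "s \<le> t" for s t :: real
      using that by (simp add: field_simps)
    show "finite {x. s \<le> u x / (v x - u x) \<and> u x / (v x - u x) \<le> t}" if s: "0 < s" for s t
    proof -
      \<comment> \<open>The increasing map \<open>r / (1 + r)\<close> carries compact intervals in
        the positive half-line to compact intervals in (0,1), where \<open>u0\<close> is
        proper.\<close>
      have "finite (u0 -` {s / (1 + s)..t / (1 + t)})" if "s \<le> t"
      proof -
        have "{s / (1 + s)..t / (1 + t)} \<subseteq> {0<..<1}"
        proof
          fix z assume z: "z \<in> {s / (1 + s)..t / (1 + t)}"
          have "0 < s / (1 + s)" "t / (1 + t) < 1" using s that by (auto simp: field_simps)
          then show "z \<in> {0<..<1}" using z by auto
        qed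
        then show ?thesis using assms(12) by (auto simp: proper_into_def)
      qed
      moreover have "{x. s \<le> r x \<and> r x \<le> t} \<subseteq> u0 -` {s / (1 + s)..t / (1 + t)}"
        using mono r(1) s by (auto simp: u0)
      moreover have "{x. s \<le> r x \<and> r x \<le> t} = {}" if "\<not> s \<le> t" using that by auto
      ultimately have "finite {x. s \<le> r x \<and> r x \<le> t}" by (metis finite.emptyI finite_subset)
      then show ?thesis by (simp add: r_def)
    qed
    show "\<exists>x. u x / (v x - u x) > t" for t
    proof (rule ccontr)
      assume "\<not> ?thesis"
      then have le: "r x \<le> t" for x by (auto simp: r_def not_less)
      \<comment> \<open>\<open>undefined\<close> serves as an arbitrary vertex.\<close>
      have t: "t > 0" using le[of undefined] r(1)[of undefined] by linarith
      have "u0 x \<le> t / (1 + t)" for x unfolding u0 by (rule mono[OF r(1) le])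
      then have "(SUP x. u0 x) \<le> t / (1 + t)" by (intro cSUP_least) auto
      also have "\<dots> < 1" using t by (simp add: field_simps)
      finally show False using assms(13) by simp
    qed
    show "u x / (v x - u x) \<le> max 1 M * (u y / (v y - u y))" if "adj b x y" for x y
    proof -
      \<comment> \<open>The quotient in (b) is exactly \<open>r x / r y\<close>.\<close>
      have "u0 x * (1 - u0 y) / (u0 y * (1 - u0 x)) = (u0 x / (1 - u0 x)) / (u0 y / (1 - u0 y))"
        by simp
      then have "r x / r y \<le> M" using M[OF that] by (simp only: r(2))
      then have "r x / r y \<le> max 1 M" by simp
      then have "r x \<le> max 1 M * r y" using r(1)[of y] by (simp only: pos_divide_le_eq)
      then show ?thesis by (simp only: r_def)
    qed
  qed
  have w: "w = P.w"
    unfolding assms(15) by (rule ext) (simp add: P.w_def P.\<psi>_def[abs_def])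
  show ?thesis
  proof (intro conjI allI impI)
    show "optimal_hardy_weight b q w" unfolding w by (rule P.optimal)
    fix x assume H: "schroedinger b q u x = 0 \<and> schroedinger b q v x = 0"
    have dom: "(\<lambda>y. b x y * (u x - u y)) summable_on UNIV"
      "(\<lambda>y. b x y * ((v x - u x) - (v y - u y))) summable_on UNIV"
      using formal_domainD(2)[OF P.graph P.f_dom] formal_domainD(2)[OF P.graph P.g_dom] by auto
    \<comment> \<open>Splitting \<open>v\<close> into \<open>u\<close> and \<open>v - u\<close>
      transfers the equation for \<open>v\<close> to \<open>v - u\<close>.\<close>
    have "laplacian b v x = laplacian b u x + laplacian b (\<lambda>x. v x - u x) x"
      unfolding laplacian_def infsum_add[OF dom, symmetric]
      by (rule infsum_cong) (simp add: algebra_simps)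
    then have "schroedinger b q (\<lambda>x. v x - u x) x = 0"
      using H by (simp add: schroedinger_def algebra_simps)
    then show "w x = 1/2 * (\<Sum>\<^sub>\<infinity>y. b x y *
        (sqrt (u y / u x) - sqrt ((v y - u y) / (v x - u x)))\<^sup>2)"
      unfolding w using H by (intro P.weight_formula) auto
  qed
qed

end
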